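(* Let $\mathcal{K}(x)=e^{-|x|}/2$ and $d>0$. Let $f:\mathbb{R}\to\mathbb{R}$ be smooth and assume there is $a\in(0,1)$ such that $f(0)=f(a)=f(1)=0$, $f<0$ on $(0,a)$, $f>0$ on $(a,1)$, $f'(0)<0$, $f'(1)<0$, $f'(a)>0$ and $\int_0^1 f(u)\,\mathrm{d}u>0$. Let $g(u):=u-\frac{f(u)}{d}$ and assume that there exist $0<\beta<\gamma<1$ such that $g'>0$ on $[0,\beta)\cup(\gamma,1]$, $g'<0$ on $(\beta,\gamma)$ and $g'(\beta)=g'(\gamma)=0$. With $\mathcal{G}_\pm$ as defined in the context, assume that $\mathcal{G}_-(g(\beta))<0$ and $-\mathcal{G}_-(g(\beta))\ge\mathcal{G}_+(1)-\mathcal{G}_+(g(\beta))$. Let $v_c\in(0,g(\beta)]\cap[g(\gamma),1)$ be such that $\mathcal{G}_+(v_c)-\mathcal{G}_-(v_c)=\mathcal{G}_+(1)$, and assume that $g(u_+)<0<v_c<g(u_-)$. Then for all $\ell>0$ the solution $u_\ell$ of the Cauchy problem $$\partial_t u = d(-u+\mathcal{K}*u)+f(u),\quad t>0,\ x\in\mathbb{R},\qquad u(0,x)=\mathbf{1}_{[-\ell,\ell]}(x),\quad x\in\mathbb{R},$$ satisfies $$\underline{U}(x)\le\liminf_{t\to+\infty}u_\ell(t,x)\le\limsup_{t\to+\infty}u_\ell(t,x)\le\overline{U}(x)\quad\text{uniformly in }x\in\mathbb{R}\setminus\{\pm\underline{x}_0,\pm\overline{x}_0\},$$ for some discontinuous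 ground states $\underline{U}$ and $\overline{U}$ with discontinuity points precisely at $\pm\underline{x}_0$ and $\pm\overline{x}_0$ respectively, with $0<\underline{x}_0\le\ell\le\overline{x}_0$.
   Context: $\mathcal{K}*u$ denotes convolution on $\mathbb{R}$ in the space variable. The Cauchy problem has a unique global solution $u_\ell\in\mathscr{C}^1((0,+\infty),L^1(\mathbb{R})\cap L^\infty(\mathbb{R}))\cap\mathscr{C}^0([0,+\infty),L^1(\mathbb{R})\cap L^\infty(\mathbb{R}))$, which is what "the solution" refers to. A ground state is a bounded, even function $U\in L^2(\mathbb{R})$, possibly discontinuous, with $0=d(-U+\mathcal{K}*U)+f(U)$ on $\mathbb{R}$, $U(\pm\infty)=0$ and $U>0$ on $\mathbb{R}$. $g_-^{-1}$ denotes the inverse of $g$ restricted to $[0,\beta]$ (defined on $[0,g(\beta)]$) and $g_+^{-1}$ the inverse of $g$ restricted to $[\gamma,1]$ (defined on $[g(\gamma),1]$). Set $$\mathcal{G}_-(V):=-\tfrac12V^2+\int_0^Vg_-^{-1}(w)\,\mathrm{d}w,\quad V\in[0,g(\beta)],\qquad \mathcal{G}_+(V):=-\tfrac12V^2-\int_V^1g_+^{-1}(w)\,\mathrm{d}w,\quad V\in[g(\gamma),1].$$ $u_+\in(\gamma,1)$ is such that $f'(u_+)=0$ and $f'(u)<0$ for all $u\in(u_+,1]$; $u_-\in(0,\beta)$ is such that $f'(u_-)=0$ and $f'(u)<0$ for all $u\in[0,u_-)$. (They exist because $f'(\beta)=f'(\gamma)=d>0$, $f'(0)<0$ and $f'(1)<0$.)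 The inequalities holding "uniformly in $x\in A$" means: for every $\varepsilon>0$ there is $T>0$ such that $\underline{U}(x)-\varepsilon\le u_\ell(t,x)\le\overline{U}(x)+\varepsilon$ for all $t\ge T$ and $x\in A$. *)

theory Defs
  imports "HOL-Analysis.Analysis" "HOL-Probability.Essential_Supremum"
begin

definition smooth :: "(real \<Rightarrow> real) \<Rightarrow> bool" where
  "smooth f \<longleftrightarrow> (\<forall>n x. (deriv ^^ n) f differentiable (at x))"

definition K :: "real \<Rightarrow> real" where
  "K x = exp (- \<bar>x\<bar>) / 2"

definition conv :: "(real \<Rightarrow> real) \<Rightarrow> (real \<Rightarrow> real) \<Rightarrow> real \<Rightarrow> real" where
  "conv k v x = (LINT y|lebesgue. k (x - y) * v y)"

definition rhs :: "real \<Rightarrow> (real \<Rightarrow> real) \<Rightarrow> (real \<Rightarrow> real) \<Rightarrow> real \<Rightarrow> real" where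
  "rhs d f v x = d * (- v x + conv K v x) + f (v x)"


text \<open>The space \<open>L\<^sup>1 \<inter> L\<^sup>\<infinity>\<close> with its norm (the sum of both norms, \<open>\<infinity>\<close> if one of them is
  infinite). Elements are functions; the norm does not see null sets.\<close>

definition L1Linf_norm :: "(real \<Rightarrow> real) \<Rightarrow> ennreal" where
  "L1Linf_norm v =
     (\<integral>\<^sup>+ x. ennreal \<bar>v x\<bar> \<partial>lebesgue) + esssup lebesgue (\<lambda>x. ennreal \<bar>v x\<bar>)"

definition L1Linf :: "(real \<Rightarrow> real) set" where
  "L1Linf = {v \<in> borel_measurable lebesgue. L1Linf_norm v < \<infinity>}"

definition C0_L1Linf :: "real set \<Rightarrow> (real \<Rightarrow> real \<Rightarrow> real) \<Rightarrow> bool" where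
  "C0_L1Linf S u \<longleftrightarrow> (\<forall>t\<in>S. u t \<in> L1Linf \<and>
     ((\<lambda>s. L1Linf_norm (\<lambda>x. u s x - u t x)) \<longlongrightarrow> 0) (at t within S))"

definition C1_L1Linf :: "real set \<Rightarrow> (real \<Rightarrow> real \<Rightarrow> real) \<Rightarrow> bool" where
  "C1_L1Linf S u \<longleftrightarrow> (\<forall>t\<in>S. u t \<in> L1Linf) \<and> (\<exists>u'. C0_L1Linf S u' \<and> (\<forall>t\<in>S.
     ((\<lambda>s. L1Linf_norm (\<lambda>x. (u s x - u t x) / (s - t) - u' t x)) \<longlongrightarrow> 0) (at t within S)))"


text \<open>The first argument of \<open>u\<close> is time. Only \<open>t \<ge> 0\<close> matters. The first two conditions determine
  each \<open>u t\<close> only up to a null set. The others state the Cauchy problem at every \<open>x\<close>; together with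
  continuity in time up to \<open>t = 0\<close> they single out the representative whose value at each \<open>x\<close>
  evolves by the equation from the initial value at that \<open>x\<close>. This gives a meaning to
  the values \<open>u t x\<close> at individual points.\<close>

definition cauchy_solution ::
    "real \<Rightarrow> (real \<Rightarrow> real) \<Rightarrow> (real \<Rightarrow> real) \<Rightarrow> (real \<Rightarrow> real \<Rightarrow> real) \<Rightarrow> bool" where
  "cauchy_solution d f u0 u \<longleftrightarrow>
     C0_L1Linf {0..} u \<and> C1_L1Linf {0<..} u \<and>
     (\<forall>x. continuous_on {0..} (\<lambda>t. u t x)) \<and>
     (\<forall>t>0. \<forall>x. ((\<lambda>s. u s x) has_real_derivative rhs d f (u t) x) (at t)) \<and>
     (\<forall>x. u 0 x = u0 x)"

definition ground_state :: "real \<Rightarrow> (real \<Rightarrow> real) \<Rightarrow> (real \<Rightarrow> real) \<Rightarrow> bool" where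
  "ground_state d f U \<longleftrightarrow>
     bounded (range U) \<and> (\<forall>x. U (- x) = U x) \<and>
     U \<in> borel_measurable lebesgue \<and> integrable lebesgue (\<lambda>x. (U x)\<^sup>2) \<and>
     (\<forall>x. 0 = rhs d f U x) \<and>
     (U \<longlongrightarrow> 0) at_top \<and> (U \<longlongrightarrow> 0) at_bot \<and>
     (\<forall>x. U x > 0)"


text \<open>The arguments \<open>\<beta>\<close> and \<open>\<gamma>\<close> select the branch of \<open>g\<close> that is inverted. The values
  are meaningful for \<open>V\<close> in \<open>{0..g \<beta>}\<close> and in \<open>{g \<gamma>..1}\<close>, respectively.\<close>

definition G_minus :: "(real \<Rightarrow> real) \<Rightarrow> real \<Rightarrow> real \<Rightarrow> real" where
  "G_minus g \<beta> V = - (1/2) * V\<^sup>2 + integral {0..V} (inv_into {0..\<beta>} g)"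

definition G_plus :: "(real \<Rightarrow> real) \<Rightarrow> real \<Rightarrow> real \<Rightarrow> real" where
  "G_plus g \<gamma> V = - (1/2) * V\<^sup>2 - integral {V..1} (inv_into {\<gamma>..1} g)"

end

theory Submission
  imports Defs "HOL-Probability.Distributions" "HOL-Real_Asymp.Real_Asymp"
begin

text \<open>
  For every \<open>x0 > 0\<close> there is a ground state whose jumps are exactly at \<open>\<plusminus>x0\<close>. In terms of
  \<open>V = K * U\<close> it solves \<open>V = K * (h V)\<close> with \<open>h\<close> the upper inverse branch of \<open>g\<close> on \<open>{-x0..x0}\<close> and the
  lower one elsewhere, both extended to \<open>\<real>\<close> as constants outside a bounded range. Both branches are
  increasing, so monotone iteration from 0 produces a solution; since the lower branch is at most
  \<open>\<theta> * V\<close> with \<open>\<theta> < 1\<close>, the solution is integrable and at most \<open>x0 / (1 - \<theta>)\<close>. Conservation of energy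
  gives \<open>V x0 \<le> v_c < g u_minus\<close>, so the artificial extension of the lower branch is never used.

  All values of \<open>U\<close> lie where \<open>f' < 0\<close>, hence \<open>U + q * exp (- \<mu> * t)\<close> is a supersolution and
  \<open>U - q * exp (- \<mu> * t)\<close> a subsolution for small \<open>q\<close>. For large \<open>x0\<close> the ground state is close to 1 on
  \<open>{-l..l}\<close>, for small \<open>x0\<close> it is small outside \<open>{-x0..x0}\<close>, so that these barriers enclose the
  indicator function at time 0.
\<close>

subsection \<open>Convolution with the exponential kernel\<close>

text \<open>The equation does not smooth: \<open>g (U x) = V x\<close> ties \<open>U\<close> to
  \<open>V\<close> point by point, so the branch may be switched anywhere and the position of the
  jump is free. The obstacle is that the chosen branch must be able to take the value
  \<open>V x\<close>. On the upper branch this is automatic: \<open>g u_plus < 0\<close> makes the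
  upper inverse defined on all of [0,1], with values above \<open>u_plus\<close>. On the lower
  branch it is a real restriction, and the energy is there to meet it. Making the lower branch
  constant already from \<open>g u_minus\<close> on, instead of \<open>g \<beta>\<close>, keeps its
  values in \<open>{0..u_minus}\<close>, where \<open>f\<close> decreases from 0 with negative slope
  at 0; there \<open>f u \<le> - c * u\<close>, whence \<open>\<theta> = d / (d + c)\<close>.

  The comparison has to cope with a solution whose norms see only classes modulo null sets, while
  the claim concerns every point. A first contact point of solution and barrier need not exist.
  Instead, a differential inequality at a fixed point halves any bound on the excess over the
  barrier that holds almost everywhere; iteration leaves 0.\<close>

lemma K_nonneg: "0 \<le> K x" and K_le_half: "K x \<le> 1 / 2" and K_even: "K (- x) = K x"
  by (simp_all add: K_def)

lemma K_antimono: "\<bar>x\<bar> \<le> \<bar>y\<bar> \<Longrightarrow> K y \<le> K x"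
  by (simp add: K_def)

lemma norm_K_mult_le: "norm (K x * c) \<le> norm (c::real)"
proof -
  have "\<bar>K x\<bar> \<le> 1" using K_nonneg[of x] K_le_half[of x] by simp
  then show ?thesis by (simp add: abs_mult mult_left_le_one_le)
qed

lemma borel_measurable_K [measurable]: "K \<in> borel_measurable borel"
  unfolding K_def by measurable

lemma has_bochner_integral_exp_Ici:
  "has_bochner_integral lborel (\<lambda>x::real. exp (- x) * indicator {0..} x) 1"
proof (rule has_bochner_integral_nn_integral)
  have "(\<integral>\<^sup>+x. ennreal (exp (- x) * indicator {0..} x) \<partial>lborel)
      = (\<integral>\<^sup>+x. ennreal (x^0 * exp (-x)) * indicator {0 ..} x \<partial>lborel)"
    by (intro nn_integral_cong) (simp split: split_indicator)
  then show "(\<integral>\<^sup>+x. ennreal (exp (- x) * indicator {0..} x) \<partial>lborel) = ennreal 1"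
    by (simp only: nn_intergal_power_times_exp_Ici fact_0) simp
qed auto

lemma has_bochner_integral_K: "has_bochner_integral lborel K 1"
proof -
  let ?e = "\<lambda>x::real. exp (- x) * indicator {0..} x"
  have 1: "has_bochner_integral lborel (\<lambda>x. ?e (0 + (-1) * x)) 1"
    using lborel_has_bochner_integral_real_affine_iff[of "-1" ?e 1 0] has_bochner_integral_exp_Ici
    by simp
  have "has_bochner_integral lborel (\<lambda>x. (?e x + ?e (0 + (-1) * x)) / 2) ((1 + 1) / 2)"
    by (intro has_bochner_integral_divide has_bochner_integral_add has_bochner_integral_exp_Ici 1)
  \<comment> \<open>The two half-line exponentials overlap only at 0, where their half sum is 1 but
    \<open>K\<close> is 1/2.\<close>
  moreover have "AE x in lborel. (?e x + ?e (0 + (-1) * x)) / 2 = K x"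
    using AE_lborel_singleton[of "0::real"]
    by eventually_elim (auto simp: K_def split: split_indicator)
  ultimately show ?thesis
    by (subst (asm) has_bochner_integral_cong_AE) auto
qed

lemma has_bochner_integral_K_shift: "has_bochner_integral lborel (\<lambda>y. K (x - y)) 1"
  using lborel_has_bochner_integral_real_affine_iff[of "-1" K 1 x] has_bochner_integral_K by simp

lemma integrable_K_shift: "integrable lborel (\<lambda>y. K (x - y))"
  and integral_K_shift: "(LINT y|lborel. K (x - y)) = 1"
  using has_bochner_integral_K_shift by (auto simp: has_bochner_integral_iff)

text \<open>\<open>conv\<close> integrates over the completed measure because a solution is only
  Lebesgue measurable. For Borel functions the integral moves to \<open>lborel\<close>, where affine
  substitution and Fubini are applied below.\<close>

lemma conv_eq_lborel:
  "v \<in> borel_measurable borel \<Longrightarrow> conv k v x = (LINT y|lborel. k (x - y) * v y)"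
  if [measurable]: "k \<in> borel_measurable borel"
  unfolding conv_def by (rule integral_completion) measurable

lemma borel_measurable_lebesgueI:
  "v \<in> borel_measurable borel \<Longrightarrow> v \<in> borel_measurable lebesgue"
  by (rule measurable_completion) simp

lemma integrable_K_mult:
  assumes [measurable]: "v \<in> borel_measurable lebesgue" and R: "AE y in lebesgue. \<bar>v y\<bar> \<le> R"
  shows "integrable lebesgue (\<lambda>y. K (x - y) * v y)"
proof (rule Bochner_Integration.integrable_bound)
  have *: "(\<lambda>y. K (x - y)) \<in> borel_measurable lebesgue"
    by (rule measurable_completion) measurable
  show "integrable lebesgue (\<lambda>y. R * K (x - y))"
    by (intro integrable_mult_right, subst integrable_completion) (auto intro: integrable_K_shift)
  show "(\<lambda>y. K (x - y) * v y) \<in> borel_measurable lebesgue"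
    using * by measurable
  show "AE y in lebesgue. norm (K (x - y) * v y) \<le> norm (R * K (x - y))"
    using R by eventually_elim
      (auto simp: abs_mult K_nonneg mult.commute[of _ "K _"] intro!: mult_left_mono)
qed

text \<open>\<open>K\<close> is nonnegative and has mass 1, so a constant passes through the
  convolution unchanged. The bounds are asked for only almost everywhere, as they will be applied to
  a solution at a fixed time.\<close>

lemma conv_K_le_plus_const:
  assumes "v \<in> borel_measurable lebesgue" "AE y in lebesgue. \<bar>v y\<bar> \<le> R"
    and "w \<in> borel_measurable lebesgue" "AE y in lebesgue. \<bar>w y\<bar> \<le> S"
    and le: "AE y in lebesgue. v y \<le> w y + c"
  shows "conv K v x \<le> conv K w x + c"
proof -
  have 1: "has_bochner_integral lebesgue (\<lambda>y. K (x - y) * c) c"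
    using has_bochner_integral_mult_left[OF has_bochner_integral_K_shift[of x], of c]
    by (simp add: has_bochner_integral_iff integrable_completion integral_completion)
  have 2: "integrable lebesgue (\<lambda>y. K (x - y) * w y + K (x - y) * c)"
    using 1 integrable_K_mult[OF assms(3,4), of x] unfolding has_bochner_integral_iff
    by (intro Bochner_Integration.integrable_add) auto
  have "conv K v x \<le> (LINT y|lebesgue. K (x - y) * w y + K (x - y) * c)"
    unfolding conv_def using le
    by (intro integral_mono_AE integrable_K_mult[OF assms(1,2)] 2)
      (auto elim!: eventually_mono simp flip: distrib_left intro!: mult_left_mono K_nonneg)
  also have "\<dots> = conv K w x + c"
    using 1 integrable_K_mult[OF assms(3,4), of x] unfolding conv_def has_bochner_integral_iff
    by (subst Bochner_Integration.integral_add) auto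
  finally show ?thesis .
qed

lemma conv_K_mono:
  assumes "v \<in> borel_measurable borel" "\<And>y. \<bar>v y\<bar> \<le> R"
    and "w \<in> borel_measurable borel" "\<And>y. \<bar>w y\<bar> \<le> S" and "\<And>y. v y \<le> w y"
  shows "conv K v x \<le> conv K w x"
  using conv_K_le_plus_const[of v R w S 0 x] assms by (simp add: borel_measurable_lebesgueI)

lemma conv_K_nonneg: "(\<And>y. 0 \<le> v y) \<Longrightarrow> 0 \<le> conv K v x"
  unfolding conv_def by (intro integral_nonneg_AE AE_I2 mult_nonneg_nonneg K_nonneg)

lemma conv_K_const: "conv K (\<lambda>_. c) x = c"
  using has_bochner_integral_mult_left[OF has_bochner_integral_K_shift[of x], of c]
  by (simp add: conv_eq_lborel has_bochner_integral_iff)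

section \<open>Symmetry, mass, decay and continuity of convolutions with \<open>K\<close>\<close>

lemma conv_K_even:
  assumes [measurable]: "v \<in> borel_measurable borel" and "\<And>y. v (- y) = v y"
  shows "conv K v (- x) = conv K v x"
proof -
  have "(LINT y|lborel. K (x - y) * v y) = (LINT y|lborel. K (x - (0 + (-1) * y)) * v (0 + (-1) * y))"
    using lborel_integral_real_affine[of "-1" "\<lambda>y. K (x - y) * v y" 0] by simp
  also have "\<dots> = (LINT y|lborel. K (- x - y) * v y)"
  proof -
    have "K (x + y) = K (- x - y)" for y using K_even[of "x + y"] by (simp add: algebra_simps)
    then show ?thesis using assms(2) by simp
  qed
  finally show ?thesis by (simp add: conv_eq_lborel)
qed

lemma integrable_K_mult_borel:
  assumes "v \<in> borel_measurable borel" "\<And>y. \<bar>v y\<bar> \<le> R"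
  shows "integrable lborel (\<lambda>y. K (x - y) * v y)"
  using integrable_K_mult[of v R x] assms
  by (subst integrable_completion[symmetric]) (auto intro: borel_measurable_lebesgueI)

text \<open>Reflecting \<open>y\<close> about the midpoint \<open>m\<close> of \<open>x\<close> and \<open>x'\<close> exchanges \<open>K (x - y)\<close> and
  \<open>K (x' - y)\<close>, so twice the difference of the two values is the integral of a product of two
  factors that both change sign only at \<open>m\<close>.\<close>

lemma conv_K_antimono:
  assumes [measurable]: "v \<in> borel_measurable borel" and R: "\<And>y. \<bar>v y\<bar> \<le> R"
    and dec: "\<And>y z. \<bar>y\<bar> \<le> \<bar>z\<bar> \<Longrightarrow> v z \<le> v y"
    and x: "0 \<le> x" "x \<le> x'"
  shows "conv K v x' \<le> conv K v x"
proof -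
  define m where "m = (x + x') / 2"
  define F where "F y = (K (x - y) - K (x' - y)) * v y" for y
  have iF: "integrable lborel F"
    unfolding F_def left_diff_distrib
    by (intro Bochner_Integration.integrable_diff integrable_K_mult_borel[OF _ R]) auto
  have diff: "conv K v x - conv K v x' = integral\<^sup>L lborel F"
    unfolding F_def left_diff_distrib
    by (subst Bochner_Integration.integral_diff)
      (auto intro!: integrable_K_mult_borel[OF _ R] simp: conv_eq_lborel)
  have "0 \<le> (LINT y|lborel. F y + F (2 * m + (-1) * y))"
  proof (intro integral_nonneg_AE AE_I2)
    fix y
    have K1: "K (x - (2 * m - y)) = K (x' - y)" "K (x' - (2 * m - y)) = K (x - y)"
      using K_even[of "x' - y"] K_even[of "x - y"] by (simp_all add: m_def add_divide_distrib)
    have eq: "F y + F (2 * m + (-1) * y) = (K (x - y) - K (x' - y)) * (v y - v (2 * m - y))"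
      using K1 by (simp add: F_def algebra_simps)
    show "0 \<le> F y + F (2 * m + (-1) * y)"
    proof (cases "y \<le> m")
      case True
      then have "K (x' - y) \<le> K (x - y)" "v (2 * m - y) \<le> v y"
        using x by (auto intro!: K_antimono dec simp: m_def abs_if field_simps)
      then show ?thesis unfolding eq by (intro mult_nonneg_nonneg) auto
    next
      case False
      then have "K (x - y) \<le> K (x' - y)" "v y \<le> v (2 * m - y)"
        using x by (auto intro!: K_antimono dec simp: m_def abs_if field_simps)
      then show ?thesis unfolding eq by (intro mult_nonpos_nonpos) auto
    qed
  qed
  also have "\<dots> = integral\<^sup>L lborel F + integral\<^sup>L lborel F"
    using lborel_integral_real_affine[of "-1" F "2 * m"] lborel_integrable_real_affine[OF iF, of "-1" "2 * m"] iF
    by (subst Bochner_Integration.integral_add) auto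
  finally show ?thesis using diff by simp
qed

text \<open>Tonelli, with the mass 1 of \<open>K\<close> in the other variable. It carries the bound
  on the integral of \<open>U\<close> over to \<open>V\<close> in the iteration.\<close>

lemma conv_K_integrable:
  assumes v: "integrable lborel v" and v0: "\<And>y. 0 \<le> v y"
  shows "integrable lborel (conv K v)" "integral\<^sup>L lborel (conv K v) = integral\<^sup>L lborel v"
proof -
  have [measurable]: "v \<in> borel_measurable borel" using v by simp
  have e: "conv K v = (\<lambda>x. LINT y|lborel. K (x - y) * v y)"
    by (rule ext) (simp add: conv_eq_lborel)
  have pos: "0 \<le> conv K v x" for x
    unfolding e by (intro integral_nonneg_AE) (simp add: K_nonneg v0)
  have meas [measurable]: "conv K v \<in> borel_measurable borel"
    unfolding e by measurable
  have K1: "(\<integral>\<^sup>+x. ennreal (K (x - y)) \<partial>lborel) = 1" for y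
  proof -
    have "(\<integral>\<^sup>+x. ennreal (K (x - y)) \<partial>lborel) = (\<integral>\<^sup>+x. ennreal (K (y - x)) \<partial>lborel)"
      using K_even[of "y - x" for x] by (intro nn_integral_cong) simp
    then show ?thesis
      using nn_integral_eq_integral[OF integrable_K_shift[of y]] integral_K_shift[of y] K_nonneg by simp
  qed
  have int: "integrable lborel (\<lambda>y. K (x - y) * v y)" for x
  proof (rule Bochner_Integration.integrable_bound[OF v])
    show "AE y in lborel. norm (K (x - y) * v y) \<le> norm (v y)"
      by (intro AE_I2 norm_K_mult_le)
  qed measurable
  have "(\<integral>\<^sup>+x. ennreal (conv K v x) \<partial>lborel) = (\<integral>\<^sup>+x. (\<integral>\<^sup>+y. ennreal (K (x - y) * v y) \<partial>lborel) \<partial>lborel)"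
    unfolding e by (intro nn_integral_cong nn_integral_eq_integral[symmetric] int AE_I2) (simp add: K_nonneg v0)
  also have "\<dots> = (\<integral>\<^sup>+y. (\<integral>\<^sup>+x. ennreal (K (x - y) * v y) \<partial>lborel) \<partial>lborel)"
    by (rule lborel_pair.Fubini') measurable
  also have "\<dots> = (\<integral>\<^sup>+y. ennreal (v y) \<partial>lborel)"
    by (intro nn_integral_cong) (simp add: ennreal_mult'' v0 nn_integral_multc K1)
  also have "\<dots> = ennreal (integral\<^sup>L lborel v)"
    using v v0 by (intro nn_integral_eq_integral) auto
  finally have "has_bochner_integral lborel (conv K v) (integral\<^sup>L lborel v)"
    using v0 pos by (intro has_bochner_integral_nn_integral) auto
  then show "integrable lborel (conv K v)" "integral\<^sup>L lborel (conv K v) = integral\<^sup>L lborel v"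
    by (auto simp: has_bochner_integral_iff)
qed

lemma conv_K_tendsto_at_top:
  assumes v: "integrable lborel v"
  shows "(conv K v \<longlongrightarrow> 0) at_top"
proof -
  have [measurable]: "v \<in> borel_measurable borel" using v by simp
  have K: "(K \<longlongrightarrow> 0) at_top"
  proof (rule Lim_transform_eventually)
    show "((\<lambda>x::real. exp (- x) / 2) \<longlongrightarrow> 0) at_top" by real_asymp
    show "\<forall>\<^sub>F x in at_top. exp (- x) / 2 = K x"
      by (auto simp: K_def eventually_at_top_linorder intro!: exI[of _ 0])
  qed
  have "((\<lambda>x. LINT y|lborel. K (x - y) * v y) \<longlongrightarrow> 0) at_top"
  proof (rule tendsto_at_topI_sequentially)
    fix s :: "nat \<Rightarrow> real" assume s: "filterlim s at_top sequentially"
    have "(\<lambda>n. LINT y|lborel. K (s n - y) * v y) \<longlonglongrightarrow> (LINT y|(lborel :: real measure). (0::real))"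
    proof (rule integral_dominated_convergence)
      show "integrable lborel (\<lambda>y. norm (v y))" using v by simp
      show "AE y in lborel. norm (K (s n - y) * v y) \<le> norm (v y)" for n
        by (intro AE_I2 norm_K_mult_le)
      have "(\<lambda>n. K (s n - y)) \<longlonglongrightarrow> 0" for y
        by (rule filterlim_compose[OF K])
          (use filterlim_tendsto_add_at_top[OF tendsto_const[of "- y"] s] in simp)
      then show "AE y in lborel. (\<lambda>n. K (s n - y) * v y) \<longlonglongrightarrow> 0"
        by (intro AE_I2 tendsto_mult_left_zero)
    qed measurable
    then show "(\<lambda>n. LINT y|lborel. K (s n - y) * v y) \<longlonglongrightarrow> 0" by simp
  qed
  moreover have "conv K v = (\<lambda>x. LINT y|lborel. K (x - y) * v y)"
    by (rule ext) (simp add: conv_eq_lborel)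
  ultimately show ?thesis by simp
qed

lemma continuous_on_conv_K:
  assumes v: "integrable lborel v"
  shows "continuous_on S (conv K v)"
proof -
  have [measurable]: "v \<in> borel_measurable borel" using v by simp
  have K: "isCont K z" for z
    unfolding K_def by (intro continuous_intros) simp
  have "isCont (conv K v) x" for x
    unfolding continuous_at_sequentially comp_def
  proof (intro allI impI)
    fix s assume s: "s \<longlonglongrightarrow> x"
    have "(\<lambda>n. LINT y|lborel. K (s n - y) * v y) \<longlonglongrightarrow> (LINT y|lborel. K (x - y) * v y)"
    proof (rule integral_dominated_convergence)
      show "integrable lborel (\<lambda>y. norm (v y))" using v by simp
      show "AE y in lborel. norm (K (s n - y) * v y) \<le> norm (v y)" for n
        using norm_K_mult_le by (intro AE_I2)
      show "AE y in lborel. (\<lambda>n. K (s n - y) * v y) \<longlonglongrightarrow> K (x - y) * v y"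
        by (intro AE_I2 tendsto_mult tendsto_const isCont_tendsto_compose[OF K] tendsto_diff s)
    qed measurable
    then show "(\<lambda>n. conv K v (s n)) \<longlonglongrightarrow> conv K v x"
      by (simp add: conv_eq_lborel)
  qed
  then show ?thesis
    by (simp add: continuous_at_imp_continuous_on)
qed

subsection \<open>Conservation of energy\<close>

text \<open>The convolution of \<open>U\<close> with the one-sided kernel exp (- s) on s \<ge> 0, a
  solution of A' = U - A. It factors the second order operator behind \<open>K\<close> into first
  order ones, so no second derivative of \<open>V\<close> has to be formed, which would fail at the
  jumps of \<open>U\<close>.\<close>

definition left_exp_mean :: "(real \<Rightarrow> real) \<Rightarrow> real \<Rightarrow> real" where
  "left_exp_mean U x = exp (- x) * (LINT y:{..x}|lborel. exp y * U y)"

lemma set_integrable_exp_mult: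
  fixes U :: "real \<Rightarrow> real"
  assumes "integrable lborel U"
  shows "set_integrable lborel {..x} (\<lambda>y. exp y * U y)"
  unfolding set_integrable_def
proof (rule Bochner_Integration.integrable_bound)
  show "integrable lborel (\<lambda>y. exp x * U y)" using assms by simp
  have [measurable]: "U \<in> borel_measurable borel" using assms by simp
  show "(\<lambda>y. indicat_real {..x} y *\<^sub>R (exp y * U y)) \<in> borel_measurable lborel" by measurable
  show "AE y in lborel. norm (indicat_real {..x} y *\<^sub>R (exp y * U y)) \<le> norm (exp x * U y)"
    by (intro AE_I2) (auto simp: abs_mult intro!: mult_right_mono split: split_indicator)
qed

lemma left_exp_mean_nonneg: "(\<And>y. 0 \<le> U y) \<Longrightarrow> 0 \<le> left_exp_mean U x"
  unfolding left_exp_mean_def set_lebesgue_integral_def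
  by (intro mult_nonneg_nonneg integral_nonneg_AE AE_I2) auto

text \<open>The part of the convolution from y > x is a mean over the right half line; since
  \<open>U\<close> is even, reflection turns it into the left mean at \<open>- x\<close>.\<close>

lemma conv_K_eq_left_exp_mean:
  assumes U: "integrable lborel U" and even: "\<And>y. U (- y) = U y"
  shows "conv K U x = (left_exp_mean U x + left_exp_mean U (- x)) / 2"
proof -
  have [measurable]: "U \<in> borel_measurable borel" using U by simp
  let ?F = "\<lambda>z y. exp (- z) * (indicator {..z} y * (exp y * U y))"
  have F: "left_exp_mean U z = integral\<^sup>L lborel (?F z)" "integrable lborel (?F z)" for z
    using set_integrable_exp_mult[OF U, of z]
    by (simp_all add: left_exp_mean_def set_lebesgue_integral_def set_integrable_def)
  have R: "integral\<^sup>L lborel (?F (- x)) = (LINT y|lborel. ?F (- x) (0 + (-1) * y))"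
    "integrable lborel (\<lambda>y. ?F (- x) (0 + (-1) * y))"
    using lborel_integral_real_affine[of "-1" "?F (- x)" 0]
      lborel_integrable_real_affine[OF F(2), of "-1" "-x" 0] by simp_all
  have "left_exp_mean U x + left_exp_mean U (- x)
      = (LINT y|lborel. ?F x y + ?F (- x) (0 + (-1) * y))"
    unfolding F(1) R(1) by (intro Bochner_Integration.integral_add[symmetric] F R)
  also have "\<dots> = (LINT y|lborel. 2 * (K (x - y) * U y))"
  proof (rule integral_cong_AE)
    show "AE y in lborel. ?F x y + ?F (- x) (0 + (-1) * y) = 2 * (K (x - y) * U y)"
      using AE_lborel_singleton[of x]
    proof eventually_elim
      case (elim y)
      have e: "exp (- x) * (exp y * c) = exp (y - x) * c" "exp x * (exp (- y) * c) = exp (x - y) * c" for c :: real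
        by (simp_all add: exp_diff exp_minus field_simps)
      show ?case
        using elim e by (cases "y < x") (auto simp: K_def even)
    qed
  qed measurable
  finally show ?thesis by (simp add: conv_eq_lborel)
qed

text \<open>The end points \<open>p\<close> and \<open>q\<close> may be jumps of \<open>U\<close>.
  Therefore \<open>U\<close> is replaced by a continuous \<phi> that agrees with it in the open
  interval only, and the derivative is taken within \<open>{p..q}\<close>.\<close>

lemma left_exp_mean_deriv:
  assumes U: "integrable lborel U" and \<phi>: "continuous_on {p..q} \<phi>"
    and eq: "\<And>y. y \<in> {p<..<q} \<Longrightarrow> U y = \<phi> y" and x: "x \<in> {p..q}"
  shows "(left_exp_mean U has_real_derivative (\<phi> x - left_exp_mean U x)) (at x within {p..q})"
proof -
  have [measurable]: "U \<in> borel_measurable borel" using U by simp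
  let ?e = "\<lambda>y. exp y * \<phi> y"
  let ?C = "LINT y:{..p}|lborel. exp y * U y"
  \<comment> \<open>The integral up to \<open>p\<close> is a constant in z. What varies is an
    integral over \<open>{p..z}\<close>, in which \<open>U\<close> may be replaced by \<phi> because
    two end points have measure 0.\<close>
  have split: "left_exp_mean U z = exp (- z) * (?C + integral {p..z} ?e)" if z: "z \<in> {p..q}" for z
  proof -
    have \<phi>z: "continuous_on {p..z} ?e"
      using z by (intro continuous_intros continuous_on_subset[OF \<phi>]) auto
    have int: "set_integrable lborel {p..z} ?e"
      by (rule borel_integrable_atLeastAtMost') (rule \<phi>z)
    have un: "{..z} = {..p} \<union> {p<..z}" using z by auto
    have "(LINT y:{..z}|lborel. exp y * U y) = ?C + (LINT y:{p<..z}|lborel. exp y * U y)"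
      unfolding un using z
      by (intro set_integral_Un set_integrable_subset[OF set_integrable_exp_mult[OF U, of z]]) auto
    also have "(LINT y:{p<..z}|lborel. exp y * U y) = (LINT y:{p..z}|lborel. ?e y)"
      unfolding set_lebesgue_integral_def
    proof (rule integral_cong_AE)
      show "(\<lambda>y. indicator {p..z} y *\<^sub>R ?e y) \<in> borel_measurable lborel"
        using int unfolding set_integrable_def by (rule borel_measurable_integrable)
      show "AE y in lborel. indicator {p<..z} y *\<^sub>R (exp y * U y) = indicator {p..z} y *\<^sub>R ?e y"
        using AE_lborel_singleton[of p] AE_lborel_singleton[of q]
        by eventually_elim (use z eq in \<open>auto split: split_indicator\<close>)
    qed measurable
    also have "\<dots> = integral {p..z} ?e"
      by (rule set_borel_integral_eq_integral) (rule int)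
    finally show ?thesis by (simp add: left_exp_mean_def)
  qed
  have "((\<lambda>z. exp (- z) * (?C + integral {p..z} ?e)) has_real_derivative
      (\<phi> x - exp (- x) * (?C + integral {p..x} ?e))) (at x within {p..q})"
    using x
    by (auto intro!: derivative_eq_intros integral_has_real_derivative continuous_intros \<phi>
        simp: exp_minus field_simps)
  then show ?thesis
    using split x unfolding has_field_derivative_def
    by (auto intro: has_derivative_transform[rotated 2])
qed

text \<open>The base point -1 makes this a primitive on both sides of 0. The integral over
  \<open>{0..v}\<close> vanishes for v < 0 and would in general have no derivative at 0, where the
  limit at infinity is taken.\<close>

definition primitive :: "(real \<Rightarrow> real) \<Rightarrow> real \<Rightarrow> real" where
  "primitive h v = integral {-1..v} h - integral {-1..0} h"

lemma primitive_0 [simp]: "primitive h 0 = 0"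
  by (simp add: primitive_def)

lemma primitive_eq:
  assumes "continuous_on UNIV h" "0 \<le> v"
  shows "primitive h v = integral {0..v} h"
proof -
  have "h integrable_on {-1..v}"
    by (rule integrable_continuous_real) (rule continuous_on_subset[OF assms(1)], simp)
  then show ?thesis
    using Henstock_Kurzweil_Integration.integral_combine[of "-1" 0 v h] assms(2)
    by (simp add: primitive_def)
qed

lemma primitive_deriv:
  assumes h: "continuous_on UNIV h" and v: "0 \<le> v"
  shows "(primitive h has_real_derivative h v) (at v)"
proof -
  have "((\<lambda>v. integral {-1..v} h) has_real_derivative h v) (at v within {-1..v + 1})"
    using v by (intro integral_has_real_derivative continuous_on_subset[OF h]) auto
  then have "((\<lambda>v. integral {-1..v} h) has_real_derivative h v) (at v)"
    using v at_within_Icc_at[of "-1" v "v + 1"] by simp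
  then have "((\<lambda>v. integral {-1..v} h - integral {-1..0} h) has_real_derivative h v) (at v)"
    by (auto intro!: derivative_eq_intros)
  then show ?thesis by (simp add: primitive_def[abs_def])
qed

text \<open>With \<open>A\<close>, \<open>B\<close> the one-sided means, \<open>V = (A + B) / 2\<close> and \<open>V' = (B - A) / 2\<close>, so that
  \<open>V'\<^sup>2 - V\<^sup>2 = - A * B\<close>: the quantity below is the mechanical energy of \<open>V'' = V - h V\<close>.\<close>

lemma conv_K_energy:
  assumes U: "integrable lborel U" and even: "\<And>y. U (- y) = U y"
    and U0: "\<And>y. 0 \<le> U y"
    and h: "continuous_on UNIV h" and H: "\<And>v. 0 \<le> v \<Longrightarrow> (H has_real_derivative h v) (at v)"
    and eq: "\<And>y. y \<in> {p<..<q} \<Longrightarrow> U y = h (conv K U y)" and pq: "p \<le> q"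
  shows "H (conv K U p) - left_exp_mean U p * left_exp_mean U (- p) / 2
       = H (conv K U q) - left_exp_mean U q * left_exp_mean U (- q) / 2"
proof -
  let ?V = "conv K U" and ?A = "left_exp_mean U"
  let ?B = "\<lambda>x. ?A (- x)" and ?\<phi> = "\<lambda>x. h (conv K U x)"
  have V: "?V = (\<lambda>x. (?A x + ?B x) / 2)"
    by (rule ext) (rule conv_K_eq_left_exp_mean[OF U even])
  have \<phi>: "continuous_on S ?\<phi>" for S
    by (rule continuous_on_compose2[OF h continuous_on_conv_K[OF U]]) auto
  have A': "(?A has_real_derivative (?\<phi> x - ?A x)) (at x within {p..q})" if "x \<in> {p..q}" for x
    by (rule left_exp_mean_deriv[OF U \<phi> eq that])
  \<comment> \<open>The right mean is the left one at \<open>- x\<close>, so its derivative comes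
    from the mirrored interval \<open>{-q..-p}\<close>; \<phi> is even there because
    \<open>K * U\<close> is.\<close>
  have B': "(?B has_real_derivative (?B x - ?\<phi> x)) (at x within {p..q})" if x: "x \<in> {p..q}" for x
  proof -
    have \<phi>': "?\<phi> (- y) = ?\<phi> y" for y
      using U by (simp add: conv_K_even even)
    have "(?A has_real_derivative (?\<phi> (- x) - ?A (- x))) (at (- x) within {-q..-p})"
      by (rule left_exp_mean_deriv[OF U \<phi>]) (use x eq[of "- y" for y] even \<phi>' in \<open>auto simp: minus_less_iff less_minus_iff\<close>)
    then have "(?A has_real_derivative (?\<phi> x - ?B x)) (at (- x) within uminus ` {p..q})"
      by (simp add: \<phi>')
    moreover have "(uminus has_real_derivative - 1) (at x within {p..q})"
      by (auto intro!: derivative_eq_intros)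
    ultimately have "(?A \<circ> uminus has_real_derivative (?\<phi> x - ?B x) * - 1) (at x within {p..q})"
      by (rule DERIV_image_chain)
    then show ?thesis by (simp add: o_def)
  qed
  have "((\<lambda>x. H (?V x) - ?A x * ?B x / 2) has_real_derivative 0) (at x within {p..q})"
    if x: "x \<in> {p..q}" for x
  proof -
    have V': "(?V has_real_derivative (?B x - ?A x) / 2) (at x within {p..q})"
      unfolding V by (auto intro!: derivative_eq_intros A' B' x)
    have "((\<lambda>x. H (?V x) - ?A x * ?B x / 2) has_real_derivative
        h (?V x) * ((?B x - ?A x) / 2) - ((?\<phi> x - ?A x) * ?B x + (?B x - ?\<phi> x) * ?A x) / 2)
        (at x within {p..q})"
      by (intro DERIV_diff DERIV_cdivide DERIV_mult A' B' x DERIV_chain2[OF H[OF conv_K_nonneg[of U x, OF U0]] V'])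
    then show ?thesis by (rule DERIV_cong) (simp add: field_simps)
  qed
  then obtain c where "\<forall>x\<in>{p..q}. H (?V x) - ?A x * ?B x / 2 = c"
    using has_field_derivative_zero_constant[of "{p..q}" "\<lambda>x. H (?V x) - ?A x * ?B x / 2"] by auto
  with pq show ?thesis by simp
qed

text \<open>The potential changes from \<open>H1\<close> to \<open>H2\<close> at \<open>x0\<close>,
  but the product of the two means is the same number in both energies and cancels. At 0 both means
  equal \<open>V 0\<close> by evenness, which gives the square; at infinity everything
  vanishes.\<close>

lemma conv_K_jump_relation:
  assumes U: "integrable lborel U" and U0: "\<And>y. 0 \<le> U y" and even: "\<And>y. U (- y) = U y"
    and h1: "continuous_on UNIV h1" "\<And>v. 0 \<le> v \<Longrightarrow> (H1 has_real_derivative h1 v) (at v)"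
    and h2: "continuous_on UNIV h2" "\<And>v. 0 \<le> v \<Longrightarrow> (H2 has_real_derivative h2 v) (at v)" "H2 0 = 0"
    and x0: "0 \<le> x0"
    and inner: "\<And>y. y \<in> {0<..<x0} \<Longrightarrow> U y = h1 (conv K U y)"
    and outer: "\<And>y. x0 < y \<Longrightarrow> U y = h2 (conv K U y)"
  shows "H1 (conv K U x0) - H2 (conv K U x0) = H1 (conv K U 0) - (conv K U 0)\<^sup>2 / 2"
proof -
  let ?V = "conv K U" and ?A = "left_exp_mean U"
  let ?c = "H2 (?V x0) - ?A x0 * ?A (- x0) / 2"
  have V0: "?A 0 = ?V 0" and V: "?V x = (?A x + ?A (- x)) / 2" for x
    using conv_K_eq_left_exp_mean[OF U even, of x] conv_K_eq_left_exp_mean[OF U even, of 0] by simp_all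
  have in_: "H1 (?V 0) - (?V 0)\<^sup>2 / 2 = H1 (?V x0) - ?A x0 * ?A (- x0) / 2"
    using conv_K_energy[OF U even U0 h1 inner x0] by (simp add: V0 power2_eq_square)
  have lim: "(?V \<longlongrightarrow> 0) at_top" by (rule conv_K_tendsto_at_top[OF U])
  \<comment> \<open>\<open>V\<close> is the average of two nonnegative means, so each is at most
    \<open>2 * V\<close> and decays with it.\<close>
  have bd: "0 \<le> ?A x" "?A x \<le> 2 * ?V x" for x
    using left_exp_mean_nonneg[of U, OF U0, of x] left_exp_mean_nonneg[of U, OF U0, of "- x"] V[of x] by auto
  have V2: "((\<lambda>x. 2 * ?V x) \<longlongrightarrow> 0) at_top" using tendsto_mult_right_zero[OF lim] .
  have "?A (- x) \<le> 2 * ?V x" for x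
    using bd(2)[of "- x"] conv_K_even[of U x] U even by simp
  then have lims: "(?A \<longlongrightarrow> 0) at_top" "((\<lambda>x. ?A (- x)) \<longlongrightarrow> 0) at_top"
    using bd by (auto intro: tendsto_sandwich[OF _ _ tendsto_const V2] always_eventually)
  have "((\<lambda>x. H2 (?V x) - ?A x * ?A (- x) / 2) \<longlongrightarrow> H2 0 - 0 * 0 / 2) at_top"
    by (intro tendsto_diff tendsto_divide tendsto_mult lims tendsto_const
        isCont_tendsto_compose[OF DERIV_isCont[OF h2(2)[of 0]] lim]) simp_all
  moreover have "\<forall>\<^sub>F x in at_top. H2 (?V x) - ?A x * ?A (- x) / 2 = ?c"
    using eventually_ge_at_top[of x0]
  proof eventually_elim
    case (elim x)
    show ?case
      by (rule conv_K_energy[where H = H2 and h = h2 and p = x0 and q = x, symmetric])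
        (use U U0 even h2 elim outer in auto)
  qed
  ultimately have "((\<lambda>x. ?c) \<longlongrightarrow> 0) (at_top :: real filter)"
    using h2(3) by (simp add: tendsto_cong)
  then have "?c = 0" by (simp add: tendsto_const_iff)
  with in_ show ?thesis by simp
qed

subsection \<open>Pinned stationary profiles\<close>

text \<open>The points at distance exactly \<open>x0\<close> are put on the upper branch, so that
  the stationary equation can hold at every single point.\<close>

definition branch_profile :: "(real \<Rightarrow> real) \<Rightarrow> (real \<Rightarrow> real) \<Rightarrow> real \<Rightarrow> (real \<Rightarrow> real) \<Rightarrow> real \<Rightarrow> real" where
  "branch_profile hp hm x0 V x = (if \<bar>x\<bar> \<le> x0 then hp (V x) else hm (V x))"

text \<open>\<open>hm_less_hp\<close> compares the branches at arbitrary, different arguments: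
  leaving the inner interval lowers the profile whatever \<open>V\<close> does. This gives
  monotonicity in the distance from 0 and a genuine jump.\<close>

locale pinned =
  fixes hp hm :: "real \<Rightarrow> real" and \<theta> x0 :: real
  assumes cont: "continuous_on UNIV hp" "continuous_on UNIV hm"
    and mono: "mono hp" "mono hm"
    and hp_pos: "0 < hp v" and hp_le_1: "hp v \<le> 1"
    and hm_nonneg: "0 \<le> hm v" and hm_le: "0 \<le> v \<Longrightarrow> hm v \<le> \<theta> * v" and hm_less_hp: "hm v < hp w"
    and \<theta>: "0 \<le> \<theta>" "\<theta> < 1" and x0: "0 < x0"
begin

abbreviation profile :: "(real \<Rightarrow> real) \<Rightarrow> real \<Rightarrow> real" where
  "profile \<equiv> branch_profile hp hm x0"

text \<open>The two bounds are the fixed points of M = x0 + \<theta> * M and I = 2 * x0 + \<theta> *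
  I, the estimates that follow from
  \<open>profile V \<le> indicator {-x0..x0} + \<theta> * V\<close>. Hence the class is mapped into
  itself. Evenness is contained in the monotonicity clause, since \<open>- x\<close> and
  \<open>x\<close> have the same absolute value.\<close>

definition admissible :: "(real \<Rightarrow> real) \<Rightarrow> bool" where
  "admissible V \<longleftrightarrow> (\<forall>x. 0 \<le> V x \<and> V x \<le> 1 \<and> V x \<le> x0 / (1 - \<theta>))
     \<and> (\<forall>x y. \<bar>x\<bar> \<le> \<bar>y\<bar> \<longrightarrow> V y \<le> V x)
     \<and> integrable lborel V \<and> integral\<^sup>L lborel V \<le> 2 * x0 / (1 - \<theta>)"

lemma borel_measurable_branches [measurable]:
  "hp \<in> borel_measurable borel" "hm \<in> borel_measurable borel"
  using cont by (auto intro: borel_measurable_continuous_onI)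

lemma borel_measurable_profile:
  assumes [measurable]: "V \<in> borel_measurable borel"
  shows "profile V \<in> borel_measurable borel"
proof -
  have "profile V = (\<lambda>x. if \<bar>x\<bar> \<le> x0 then hp (V x) else hm (V x))"
    by (rule ext) (simp add: branch_profile_def)
  then show ?thesis by simp
qed

lemma profile_bounds: "0 \<le> profile V x" "profile V x \<le> 1"
  using hp_pos[of "V x"] hp_le_1[of "V x"] hm_nonneg[of "V x"] hm_less_hp[of "V x" "V x"]
  by (auto simp: branch_profile_def)

lemma abs_profile_le: "\<bar>profile V x\<bar> \<le> 1"
  using profile_bounds[of V x] by simp

lemma profile_mono: "V x \<le> W x \<Longrightarrow> profile V x \<le> profile W x"
  using mono by (auto simp: branch_profile_def mono_def)

lemma profile_antimono:
  assumes "\<bar>x\<bar> \<le> \<bar>y\<bar>" "V y \<le> V x"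
  shows "profile V y \<le> profile V x"
  using mono assms hm_less_hp[of "V y" "V x"] by (auto simp: branch_profile_def mono_def)

lemma profile_le: "0 \<le> V x \<Longrightarrow> profile V x \<le> indicator {-x0..x0} x + \<theta> * V x"
  using hp_le_1[of "V x"] hm_le[of "V x"] \<theta>
  by (auto simp: branch_profile_def indicator_def intro: order_trans[OF hp_le_1])

lemma borel_measurable_admissible: "admissible V \<Longrightarrow> V \<in> borel_measurable borel"
  unfolding admissible_def by (auto dest: borel_measurable_integrable)

lemma borel_measurable_profile_admissible: "admissible V \<Longrightarrow> profile V \<in> borel_measurable borel"
  by (intro borel_measurable_profile borel_measurable_admissible)

lemma integrable_profile:
  assumes "admissible V"
  shows "integrable lborel (profile V)" "integral\<^sup>L lborel (profile V) \<le> 2 * x0 / (1 - \<theta>)"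
proof -
  have V: "integrable lborel V" "\<And>x. 0 \<le> V x" "integral\<^sup>L lborel V \<le> 2 * x0 / (1 - \<theta>)"
    using assms by (auto simp: admissible_def)
  let ?w = "\<lambda>x. indicator {-x0..x0} x + \<theta> * V x"
  have w: "integrable lborel ?w" using V(1) x0 by simp
  show 1: "integrable lborel (profile V)"
  proof (rule Bochner_Integration.integrable_bound[OF w])
    show "AE x in lborel. norm (profile V x) \<le> norm (?w x)"
      using profile_le[of V] V(2) profile_bounds[of V] \<theta> by (auto simp: order_trans[OF _ abs_ge_self])
  qed (use borel_measurable_profile[of V] V in auto)
  have "integral\<^sup>L lborel (profile V) \<le> integral\<^sup>L lborel ?w"
    using V by (intro integral_mono 1 w profile_le)
  also have "\<dots> = 2 * x0 + \<theta> * integral\<^sup>L lborel V"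
    using V(1) x0 by (subst Bochner_Integration.integral_add) auto
  also have "\<dots> \<le> 2 * x0 + \<theta> * (2 * x0 / (1 - \<theta>))"
    using V(3) \<theta> by (intro add_left_mono mult_left_mono) auto
  also have "\<dots> = 2 * x0 / (1 - \<theta>)" using \<theta> by (simp add: field_simps)
  finally show "integral\<^sup>L lborel (profile V) \<le> 2 * x0 / (1 - \<theta>)" .
qed

text \<open>The kernel is at most 1/2 and the interval has length \<open>2 * x0\<close>.\<close>

lemma conv_K_indicator_le: "conv K (indicator {-x0..x0}) x \<le> x0"
proof -
  have "conv K (indicator {-x0..x0}) x = (LINT y|lborel. K (x - y) * indicator {-x0..x0} y)"
    by (simp add: conv_eq_lborel)
  also have "\<dots> \<le> (LINT y|lborel. 1 / 2 * indicator {-x0..x0} y)"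
  proof (rule integral_mono)
    show "integrable lborel (\<lambda>y. K (x - y) * indicator {-x0..x0} y)"
      by (rule integrable_K_mult_borel[where R = 1]) auto
    show "integrable lborel (\<lambda>y. 1 / 2 * indicat_real {-x0..x0} y)"
      using x0 by (intro integrable_mult_right) simp
  qed (use K_le_half in \<open>auto simp: indicator_def\<close>)
  also have "\<dots> = x0" using x0 by simp
  finally show ?thesis .
qed

lemma conv_K_profile_admissible:
  assumes V: "admissible V"
  shows "admissible (conv K (profile V))"
proof -
  let ?u = "profile V"
  have [measurable]: "V \<in> borel_measurable borel" by (rule borel_measurable_admissible[OF V])
  have u [measurable]: "?u \<in> borel_measurable borel" by (rule borel_measurable_profile) measurable
  have even: "?u (- y) = ?u y" and anti: "\<bar>y\<bar> \<le> \<bar>z\<bar> \<Longrightarrow> ?u z \<le> ?u y" for y z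
    using V profile_antimono[of y z V] profile_antimono[of "- y" y V] profile_antimono[of y "- y" V]
    by (auto simp: admissible_def intro!: antisym)
  have V01: "0 \<le> V y" "V y \<le> x0 / (1 - \<theta>)" for y
    using V by (auto simp: admissible_def)
  have "conv K (\<lambda>_. 0) x \<le> conv K ?u x" "conv K ?u x \<le> conv K (\<lambda>_. 1) x" for x
    by (rule conv_K_mono[where R = 1 and S = 1]; simp add: profile_bounds abs_profile_le u)+
  then have 1: "0 \<le> conv K ?u x" "conv K ?u x \<le> 1" for x
    by (simp_all add: conv_K_const)
  have 2: "conv K ?u x \<le> x0 / (1 - \<theta>)" for x
  proof -
    have "?u y \<le> indicator {-x0..x0} y + \<theta> * (x0 / (1 - \<theta>))" for y
      using V01[of y] \<theta> profile_le[of V y] mult_left_mono[of "V y" "x0 / (1 - \<theta>)" \<theta>] by linarith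
    then have "conv K ?u x \<le> conv K (indicator {-x0..x0}) x + \<theta> * (x0 / (1 - \<theta>))"
      by (intro conv_K_le_plus_const[where R = 1 and S = 1] borel_measurable_lebesgueI AE_I2)
        (auto simp: abs_profile_le)
    also have "\<dots> \<le> x0 + \<theta> * (x0 / (1 - \<theta>))" by (simp add: conv_K_indicator_le)
    also have "\<dots> = x0 / (1 - \<theta>)" using \<theta> by (simp add: field_simps)
    finally show ?thesis .
  qed
  have 3: "conv K ?u y \<le> conv K ?u x" if "\<bar>x\<bar> \<le> \<bar>y\<bar>" for x y
  proof -
    have "conv K ?u \<bar>z\<bar> = conv K ?u z" for z
      using conv_K_even[of ?u z, OF u even] by (auto simp: abs_if)
    then show ?thesis
      using conv_K_antimono[of ?u 1 "\<bar>x\<bar>" "\<bar>y\<bar>", OF u abs_profile_le anti] that by simp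
  qed
  show ?thesis
    unfolding admissible_def
    using 1 2 3 conv_K_integrable[OF integrable_profile(1)[OF V] profile_bounds(1)] integrable_profile(2)[OF V]
    by auto
qed

section \<open>Existence of a fixed point and lower bounds for it\<close>

definition iterate :: "nat \<Rightarrow> real \<Rightarrow> real" where
  "iterate n = ((\<lambda>V. conv K (profile V)) ^^ n) (\<lambda>_. 0)"

lemma iterate_Suc: "iterate (Suc n) = conv K (profile (iterate n))"
  by (simp add: iterate_def)

lemma admissible_iterate: "admissible (iterate n)"
proof (induction n)
  case 0
  then show ?case using x0 \<theta> by (simp add: iterate_def admissible_def)
next
  case (Suc n)
  then show ?case by (simp add: iterate_Suc conv_K_profile_admissible)
qed

lemma iterate_le_Suc: "iterate n x \<le> iterate (Suc n) x"
proof (induction n arbitrary: x)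
  case 0
  then show ?case using admissible_iterate[of 1] by (simp add: iterate_def admissible_def)
next
  case (Suc n)
  show ?case
    unfolding iterate_Suc[of "Suc n"] unfolding iterate_Suc[of n]
    using Suc by (intro conv_K_mono[where R = 1 and S = 1])
      (simp_all add: abs_profile_le profile_mono borel_measurable_profile
         borel_measurable_admissible[OF admissible_iterate] flip: iterate_Suc)
qed

text \<open>Boundedness by 1 gives a pointwise limit, and the bound on the integrals keeps it
  integrable. Continuity of both branches and dominated convergence with majorant K (x - y) pass the
  limit through the convolution.\<close>

theorem fixed_profile_exists:
  obtains V where "admissible V" "\<And>x. V x = conv K (profile V) x"
proof -
  define V where "V x = lim (\<lambda>n. iterate n x)" for x
  have it: "0 \<le> iterate n x" "iterate n x \<le> 1" "iterate n x \<le> x0 / (1 - \<theta>)"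
    "integrable lborel (iterate n)" "integral\<^sup>L lborel (iterate n) \<le> 2 * x0 / (1 - \<theta>)"
    "\<bar>x\<bar> \<le> \<bar>y\<bar> \<Longrightarrow> iterate n y \<le> iterate n x" for n x y
    using admissible_iterate[of n] by (auto simp: admissible_def)
  have inc: "incseq (\<lambda>n. iterate n x)" for x
    by (rule incseq_SucI) (rule iterate_le_Suc)
  have lim: "(\<lambda>n. iterate n x) \<longlonglongrightarrow> V x" for x
  proof -
    obtain L where "(\<lambda>n. iterate n x) \<longlonglongrightarrow> L"
      using incseq_convergent[OF inc, of x 1] it(2) by blast
    then show ?thesis unfolding V_def by (simp add: limI)
  qed
  have [measurable]: "V \<in> borel_measurable borel"
    using borel_measurable_LIMSEQ_metric[of iterate borel V] lim borel_measurable_admissible[OF admissible_iterate]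
    by auto
  have "incseq (\<lambda>n. integral\<^sup>L lborel (iterate n))"
    by (rule incseq_SucI) (intro integral_mono it iterate_le_Suc)
  then obtain I where I: "(\<lambda>n. integral\<^sup>L lborel (iterate n)) \<longlonglongrightarrow> I"
    using incseq_convergent[of _ "2 * x0 / (1 - \<theta>)"] it(5) by blast
  have iV: "integrable lborel V" "integral\<^sup>L lborel V = I"
    by (rule integral_monotone_convergence_nonneg[OF it(4) _ _ _ I];
        use inc it lim in \<open>auto simp: incseq_def mono_def\<close>)+
  have adm: "admissible V"
    unfolding admissible_def
  proof (intro conjI allI impI)
    fix x y :: real
    show "0 \<le> V x" using it(1) by (intro LIMSEQ_le_const[OF lim]) auto
    show "V x \<le> 1" using it(2) by (intro LIMSEQ_le_const2[OF lim]) auto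
    show "V x \<le> x0 / (1 - \<theta>)" using it(3) by (intro LIMSEQ_le_const2[OF lim]) auto
    show "V y \<le> V x" if "\<bar>x\<bar> \<le> \<bar>y\<bar>"
      using it(6)[OF that] by (intro LIMSEQ_le[OF lim lim]) auto
    show "integrable lborel V" by (rule iV)
    show "integral\<^sup>L lborel V \<le> 2 * x0 / (1 - \<theta>)"
      unfolding iV(2) using it(5) by (intro LIMSEQ_le_const2[OF I]) auto
  qed
  have "V x = conv K (profile V) x" for x
  proof -
    have "isCont hp v" "isCont hm v" for v
      using cont by (auto simp: continuous_on_eq_continuous_at)
    then have pl: "(\<lambda>n. profile (iterate n) y) \<longlonglongrightarrow> profile V y" for y
      unfolding branch_profile_def using lim[of y] by (auto intro: isCont_tendsto_compose)
    have [measurable]: "profile V \<in> borel_measurable borel" "profile (iterate n) \<in> borel_measurable borel" for n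
      by (auto intro!: borel_measurable_profile_admissible adm admissible_iterate)
    have "(\<lambda>n. LINT y|lborel. K (x - y) * profile (iterate n) y) \<longlonglongrightarrow> (LINT y|lborel. K (x - y) * profile V y)"
    proof (rule integral_dominated_convergence[OF _ _ integrable_K_shift])
      show "AE y in lborel. norm (K (x - y) * profile (iterate n) y) \<le> K (x - y)" for n
        by (auto simp: abs_mult K_nonneg abs_profile_le mult_left_le)
      show "AE y in lborel. (\<lambda>n. K (x - y) * profile (iterate n) y) \<longlonglongrightarrow> K (x - y) * profile V y"
        by (intro AE_I2 tendsto_mult tendsto_const pl)
    qed measurable
    then have "(\<lambda>n. iterate (Suc n) x) \<longlonglongrightarrow> conv K (profile V) x"
      by (simp add: iterate_Suc conv_eq_lborel)
    then show ?thesis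
      by (rule LIMSEQ_unique[OF LIMSEQ_Suc[OF lim]])
  qed
  with adm show ?thesis by (rule that)
qed

text \<open>The inner interval alone suffices: there the profile is at least \<open>hp 0 > 0\<close>
  and the kernel at least \<open>K (\<bar>x\<bar> + x0)\<close>.\<close>

lemma fixed_profile_pos:
  assumes V: "admissible V" and fp: "\<And>x. V x = conv K (profile V) x"
  shows "0 < V x"
proof -
  let ?w = "\<lambda>y. K (\<bar>x\<bar> + x0) * hp 0 * indicator {-x0..x0} y"
  have "0 < (LINT y|lborel. ?w y)"
    using x0 hp_pos by (simp add: K_def)
  also have "\<dots> \<le> (LINT y|lborel. K (x - y) * profile V y)"
  proof (rule integral_mono)
    show "integrable lborel ?w" using x0 by simp
    show "integrable lborel (\<lambda>y. K (x - y) * profile V y)"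
      by (intro integrable_K_mult_borel[where R = 1] borel_measurable_profile_admissible V abs_profile_le)
    fix y
    show "?w y \<le> K (x - y) * profile V y"
    proof (cases "\<bar>y\<bar> \<le> x0")
      case True
      have "hp 0 \<le> hp (V y)" using mono(1) V by (auto simp: mono_def admissible_def)
      moreover have "K (\<bar>x\<bar> + x0) \<le> K (x - y)" using True x0 by (intro K_antimono) auto
      ultimately have "K (\<bar>x\<bar> + x0) * hp 0 \<le> K (x - y) * hp (V y)"
        using hp_pos[of 0] by (intro mult_mono) (simp_all add: K_nonneg)
      with True show ?thesis by (simp add: branch_profile_def indicator_def abs_le_iff)
    next
      case False
      then show ?thesis
        by (auto simp: indicator_def abs_le_iff intro!: mult_nonneg_nonneg K_nonneg profile_bounds)
    qed
  qed
  finally show ?thesis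
    by (simp add: fp[of x] conv_eq_lborel borel_measurable_profile_admissible V)
qed

lemma conv_K_profile_eq:
  "admissible V \<Longrightarrow> conv K (profile V) x = (LINT y|lborel. K (x - y) * profile V y)"
  by (simp add: conv_eq_lborel borel_measurable_profile_admissible)

text \<open>Each step inwards by the distance \<open>R\<close> gains \<delta>, because a kernel
  truncated at radius \<open>R\<close> already lifts \<open>v\<close> to
  \<open>v + \<delta>\<close>. The cap \<open>m\<close> restricts this demand to a range in which
  \<open>hp v\<close> exceeds \<open>v\<close> by a fixed amount; at the equilibrium 1 there is no
  gain.\<close>

lemma fixed_profile_ge:
  assumes V: "admissible V" and fp: "\<And>x. V x = conv K (profile V) x"
    and R: "0 < R" and \<delta>: "0 \<le> \<delta>" and m: "0 \<le> m"
    and step: "\<And>v. 0 \<le> v \<Longrightarrow> v \<le> m \<Longrightarrow> v + \<delta> \<le> (LINT y|lborel. K y * indicator {-R..R} y) * hp v"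
  shows "\<bar>x\<bar> \<le> x0 - real n * R \<Longrightarrow> min (real n * \<delta>) m \<le> V x"
proof (induction n arbitrary: x)
  case 0
  then show ?case using V m by (simp add: admissible_def)
next
  case (Suc n)
  define v where "v = min (real n * \<delta>) m"
  have v: "0 \<le> v" "v \<le> m" using \<delta> m by (simp_all add: v_def)
  \<comment> \<open>Only points y within distance \<open>R\<close> of x are counted. They have
    \<open>\<bar>y\<bar> \<le> x0 - real n * R\<close>, so the induction hypothesis applies to them
    and they lie on the upper branch.\<close>
  let ?w = "\<lambda>y. hp v * (K (x - y) * indicator {-R..R} (x - y))"
  have K_ind: "integrable lborel (\<lambda>y. K y * indicat_real {-R..R} y)"
    using has_bochner_integral_K
    by (intro integrable_real_mult_indicator) (auto simp: has_bochner_integral_iff)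
  have "min (real (Suc n) * \<delta>) m \<le> v + \<delta>" using \<delta> by (auto simp: v_def algebra_simps)
  also have "\<dots> \<le> (LINT y|lborel. K y * indicator {-R..R} y) * hp v" using v by (rule step)
  also have "\<dots> = (LINT y|lborel. ?w y)"
    using lborel_integral_real_affine[of "-1" "\<lambda>y. K y * indicator {-R..R} y" x] by simp
  also have "\<dots> \<le> (LINT y|lborel. K (x - y) * profile V y)"
  proof (rule integral_mono)
    show "integrable lborel ?w"
      using lborel_integrable_real_affine[OF K_ind, of "-1" x] by simp
    show "integrable lborel (\<lambda>y. K (x - y) * profile V y)"
      by (intro integrable_K_mult_borel[where R = 1] borel_measurable_profile_admissible V abs_profile_le)
    fix y
    show "?w y \<le> K (x - y) * profile V y"
    proof (cases "\<bar>x - y\<bar> \<le> R")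
      case True
      then have y: "\<bar>y\<bar> \<le> x0 - real n * R" using Suc.prems by (auto simp: algebra_simps)
      moreover have "0 \<le> real n * R" using R by simp
      ultimately have "\<bar>y\<bar> \<le> x0" by linarith
      moreover have "hp v \<le> hp (V y)"
        using mono(1) Suc.IH[OF y] by (auto simp: mono_def v_def)
      ultimately show ?thesis
        using True K_nonneg[of "x - y"]
        by (auto simp: branch_profile_def indicator_def mult.commute abs_le_iff intro!: mult_right_mono)
    next
      case False
      then show ?thesis
        by (auto simp: indicator_def abs_le_iff intro!: mult_nonneg_nonneg K_nonneg profile_bounds)
    qed
  qed
  finally show ?case by (simp add: fp[of x] conv_K_profile_eq V)
qed

section \<open>Symmetry, jump and decay of the fixed point\<close>

lemma fixed_profile_even:
  assumes "admissible V"
  shows "V (- x) = V x" "profile V (- x) = profile V x"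
proof -
  show "V (- x) = V x" using assms by (auto simp: admissible_def intro: antisym)
  then show "profile V (- x) = profile V x" by (simp add: branch_profile_def)
qed

text \<open>The energy is constant on either side of the jump. It vanishes at infinity, and at the center
  it is at most its value at the equilibrium 1, which is the value that defines \<open>v\<^sub>c\<close>.\<close>

lemma jump_value_le:
  assumes V: "admissible V" and fp: "\<And>x. V x = conv K (profile V) x"
    and hp_ge: "\<And>v. 0 \<le> v \<Longrightarrow> v \<le> 1 \<Longrightarrow> v \<le> hp v"
    and vc: "0 \<le> vc"
    and eq: "integral {0..vc} hp - integral {0..vc} hm = integral {0..1} hp - 1 / 2"
  shows "V x0 \<le> vc"
proof -
  let ?P = "primitive hp" and ?M = "primitive hm"
  have V01: "0 \<le> V x" "V x \<le> 1" for x using V by (auto simp: admissible_def)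
  have P: "(?P has_real_derivative hp v) (at v)" and M: "(?M has_real_derivative hm v) (at v)"
    if "0 \<le> v" for v
    using that by (auto intro!: primitive_deriv cont)
  have fp': "conv K (profile V) = V" using fp by auto
  have jump: "?P (V x0) - ?M (V x0) = ?P (V 0) - (V 0)\<^sup>2 / 2"
    using x0
    by (intro conv_K_jump_relation[of "profile V" hp ?P hm ?M x0, unfolded fp'] integrable_profile V profile_bounds fixed_profile_even
      cont P M primitive_0) (auto simp: branch_profile_def)
  have "?P (V 0) - (V 0)\<^sup>2 / 2 \<le> ?P 1 - 1\<^sup>2 / 2"
  proof (rule DERIV_nonneg_imp_nondecreasing[OF V01(2)])
    fix v assume v: "V 0 \<le> v" "v \<le> 1"
    then have v0: "0 \<le> v" using V01(1)[of 0] by simp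
    have "((\<lambda>v. ?P v - v\<^sup>2 / 2) has_real_derivative (hp v - v)) (at v)"
      by (auto intro!: derivative_eq_intros P v0)
    moreover have "0 \<le> hp v - v" using hp_ge v v0 by simp
    ultimately show "\<exists>y. ((\<lambda>v. ?P v - v\<^sup>2 / 2) has_real_derivative y) (at v) \<and> 0 \<le> y" by blast
  qed
  also have "\<dots> = ?P vc - ?M vc"
    using eq vc by (simp add: primitive_eq cont)
  finally have le: "?P (V x0) - ?M (V x0) \<le> ?P vc - ?M vc" using jump by simp
  \<comment> \<open>The difference of the primitives increases strictly because
    \<open>hm < hp\<close>, so comparing its values compares the arguments.\<close>
  show ?thesis
  proof (rule ccontr)
    assume "\<not> V x0 \<le> vc"
    then have "vc < V x0" by simp
    then have "?P vc - ?M vc < ?P (V x0) - ?M (V x0)"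
    proof (rule DERIV_pos_imp_increasing)
      fix v assume "vc \<le> v" "v \<le> V x0"
      then have "0 \<le> v" using vc by simp
      then have "((\<lambda>v. ?P v - ?M v) has_real_derivative (hp v - hm v)) (at v)"
        by (intro DERIV_diff P M)
      then show "\<exists>y. ((\<lambda>v. ?P v - ?M v) has_real_derivative y) (at v) \<and> 0 < y"
        using hm_less_hp[of v v] by (intro exI[of _ "hp v - hm v"]) simp
    qed
    with le show False by simp
  qed
qed

lemma isCont_fixed_profile:
  assumes V: "admissible V" and fp: "\<And>x. V x = conv K (profile V) x"
  shows "isCont V x"
proof -
  have "V = conv K (profile V)" using fp by auto
  then have "continuous_on UNIV V"
    using continuous_on_conv_K[OF integrable_profile(1)[OF V], of UNIV] by simp
  then show ?thesis by (simp add: continuous_on_eq_continuous_at)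
qed

lemma isCont_branches: "isCont hp v" "isCont hm v"
  using cont by (auto simp: continuous_on_eq_continuous_at)

text \<open>\<open>V\<close> is continuous, so \<open>U\<close> is continuous wherever the branch
  does not change. At \<open>x0\<close> the value lies on the upper branch and the limit from the
  right on the lower one, and these never meet.\<close>

lemma profile_discontinuities:
  assumes V: "admissible V" and fp: "\<And>x. V x = conv K (profile V) x"
  shows "{x. \<not> isCont (profile V) x} = {- x0, x0}"
proof -
  have hp: "isCont (\<lambda>y. hp (V y)) x" and hm: "isCont (\<lambda>y. hm (V y)) x" for x
    by (rule isCont_o2[OF isCont_fixed_profile[OF V fp]], rule isCont_branches)+
  have in_: "isCont (profile V) x" if "\<bar>x\<bar> < x0" for x
  proof -
    have "\<forall>\<^sub>F y in nhds x. y \<in> {-x0<..<x0}"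
      using that by (intro eventually_nhds_in_open) auto
    then have "\<forall>\<^sub>F y in nhds x. profile V y = hp (V y)"
      by eventually_elim (auto simp: branch_profile_def)
    then show ?thesis using hp by (simp add: isCont_cong)
  qed
  have out: "isCont (profile V) x" if "x0 < \<bar>x\<bar>" for x
  proof -
    have "\<forall>\<^sub>F y in nhds x. y \<in> - {-x0..x0}"
      using that by (intro eventually_nhds_in_open) auto
    then have "\<forall>\<^sub>F y in nhds x. profile V y = hm (V y)"
      by eventually_elim (auto simp: branch_profile_def abs_if split: if_splits)
    then show ?thesis using hm by (simp add: isCont_cong)
  qed
  have jump: "\<not> isCont (profile V) x0"
  proof
    assume "isCont (profile V) x0"
    then have 1: "(profile V \<longlongrightarrow> profile V x0) (at_right x0)"
      by (auto simp: isCont_def intro: tendsto_within_subset)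
    have "((\<lambda>y. hm (V y)) \<longlongrightarrow> hm (V x0)) (at_right x0)"
      using hm[of x0] by (auto simp: isCont_def intro: tendsto_within_subset)
    moreover have "\<forall>\<^sub>F y in at_right x0. hm (V y) = profile V y"
      using eventually_at_right_less by eventually_elim (use x0 in \<open>auto simp: branch_profile_def\<close>)
    ultimately have "(profile V \<longlongrightarrow> hm (V x0)) (at_right x0)"
      by (rule Lim_transform_eventually)
    then have "hm (V x0) = profile V x0"
      using 1 by (rule tendsto_unique[rotated]) simp
    then show False using hm_less_hp[of "V x0" "V x0"] x0 by (simp add: branch_profile_def)
  qed
  have "\<not> isCont (profile V) (- x0)"
  proof
    assume "isCont (profile V) (- x0)"
    then have "isCont (\<lambda>y. profile V (- y)) x0"
      using isCont_o2[of x0 uminus "profile V"] by simp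
    then show False using jump fixed_profile_even[OF V] by simp
  qed
  moreover have "x = x0 \<or> x = - x0" if "\<not> isCont (profile V) x" for x
  proof -
    have "\<bar>x\<bar> = x0" using in_ out that by (metis linorder_neqE_linordered_idom)
    then show ?thesis by auto
  qed
  ultimately show ?thesis using jump by auto
qed

lemma profile_tendsto_0:
  assumes V: "admissible V" and fp: "\<And>x. V x = conv K (profile V) x"
  shows "(profile V \<longlongrightarrow> 0) at_top" "(profile V \<longlongrightarrow> 0) at_bot"
proof -
  have "V = conv K (profile V)" using fp by auto
  then have "(V \<longlongrightarrow> 0) at_top"
    using conv_K_tendsto_at_top[OF integrable_profile(1)[OF V]] by simp
  then have lim: "((\<lambda>x. \<theta> * V x) \<longlongrightarrow> 0) at_top" by (rule tendsto_mult_right_zero)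
  show top: "(profile V \<longlongrightarrow> 0) at_top"
  proof (rule tendsto_sandwich[OF _ _ tendsto_const lim])
    show "\<forall>\<^sub>F x in at_top. profile V x \<le> \<theta> * V x"
      using eventually_gt_at_top[of x0]
      by eventually_elim (use x0 V hm_le in \<open>auto simp: branch_profile_def admissible_def\<close>)
  qed (simp add: profile_bounds)
  then show "(profile V \<longlongrightarrow> 0) at_bot"
    by (simp add: filterlim_at_bot_mirror fixed_profile_even[OF V])
qed

lemma ground_state_profile:
  assumes V: "admissible V" and fp: "\<And>x. V x = conv K (profile V) x"
    and stat: "\<And>x. d * (V x - profile V x) + f (profile V x) = 0"
    and pos: "\<And>v. 0 < v \<Longrightarrow> 0 < hm v"
  shows "ground_state d f (profile V)"
  unfolding ground_state_def
proof (intro conjI allI)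
  note [measurable] = borel_measurable_profile_admissible[OF V]
  show "bounded (range (profile V))"
    by (auto simp: bounded_iff intro!: exI[of _ 1] abs_profile_le)
  show "profile V \<in> borel_measurable lebesgue" by (rule borel_measurable_lebesgueI) measurable
  have "integrable lborel (\<lambda>x. (profile V x)\<^sup>2)"
  proof (rule Bochner_Integration.integrable_bound[OF integrable_profile(1)[OF V]])
    show "AE x in lborel. norm ((profile V x)\<^sup>2) \<le> norm (profile V x)"
      using profile_bounds[of V] by (intro AE_I2) (simp add: power2_eq_square mult_left_le)
  qed measurable
  then show "integrable lebesgue (\<lambda>x. (profile V x)\<^sup>2)"
    by (subst integrable_completion) auto
  show "profile V (- x) = profile V x" for x by (rule fixed_profile_even[OF V])
  show "0 = rhs d f (profile V) x" for x using stat[of x] by (simp add: rhs_def fp[symmetric])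
  show "0 < profile V x" for x
    using pos[OF fixed_profile_pos[OF V fp]] hp_pos by (simp add: branch_profile_def)
qed (rule profile_tendsto_0[OF V fp])+

end

subsection \<open>Comparison with a stable stationary solution\<close>

text \<open>After the last time with \<open>y \<le> 0\<close> the function is positive, hence
  nonincreasing, so it cannot have become positive. A sign of the derivative is available in the
  application only while \<open>y\<close> is positive.\<close>

lemma nonpos_if_deriv_nonpos_where_pos:
  fixes y :: "real \<Rightarrow> real"
  assumes cont: "continuous_on {0..T} y" and y0: "y 0 \<le> 0" and t: "0 \<le> t" "t \<le> T"
    and deriv: "\<And>s. 0 < s \<Longrightarrow> s \<le> T \<Longrightarrow> 0 < y s \<Longrightarrow> \<exists>D\<le>0. (y has_real_derivative D) (at s)"
  shows "y t \<le> 0"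
proof (rule ccontr)
  assume yt: "\<not> y t \<le> 0"
  define S where "S = {s \<in> {0..t}. y s \<le> 0}"
  have ct: "continuous_on {0..t} y" using cont t by (auto intro: continuous_on_subset)
  have "closed S"
    unfolding S_def using ct by (intro continuous_on_closed_Collect_le) auto
  moreover have S: "S \<noteq> {}" "bdd_above S"
    using y0 t by (auto simp: S_def intro!: bdd_aboveI[of _ t])
  ultimately have "Sup S \<in> S" by (rule closed_contains_Sup[rotated -1])
  then have s: "0 \<le> Sup S" "Sup S \<le> t" "y (Sup S) \<le> 0" by (auto simp: S_def)
  with yt have lt: "Sup S < t" by (metis order_le_less)
  have pos: "0 < y r" if "Sup S < r" "r \<le> t" for r
    using cSup_upper[OF _ S(2), of r] that s(1) by (force simp: S_def)
  have "\<exists>l z. Sup S < z \<and> z < t \<and> (y has_real_derivative l) (at z) \<and> y t - y (Sup S) = (t - Sup S) * l"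
  proof (rule MVT[OF lt])
    show "continuous_on {Sup S..t} y" using ct s by (auto intro: continuous_on_subset)
    fix r assume "Sup S < r" "r < t"
    then show "y differentiable at r"
      using deriv[of r] pos[of r] s t by (auto simp: real_differentiable_def)
  qed
  then obtain l z where z: "Sup S < z" "z < t" "(y has_real_derivative l) (at z)"
    and eq: "y t - y (Sup S) = (t - Sup S) * l" by blast
  have "l \<le> 0" using deriv[of z] pos[of z] z s t DERIV_unique by fastforce
  then have "(t - Sup S) * l \<le> 0" using lt by (simp add: mult_nonneg_nonpos)
  with eq s yt show False by simp
qed

text \<open>An ordinary differential equation in time at every x, where different points interact
  only through the convolution and thus only up to null sets.\<close>

locale pointwise_solution =
  fixes d :: real and f :: "real \<Rightarrow> real" and u :: "real \<Rightarrow> real \<Rightarrow> real"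
  assumes measurable: "0 \<le> t \<Longrightarrow> u t \<in> borel_measurable lebesgue"
    and AE_bounded: "\<exists>R. \<forall>t\<in>{0..T}. AE x in lebesgue. \<bar>u t x\<bar> \<le> R"
    and continuous: "continuous_on {0..} (\<lambda>t. u t x)"
    and ode: "0 < t \<Longrightarrow> ((\<lambda>s. u s x) has_real_derivative rhs d f (u t) x) (at t)"
begin

text \<open>The exceptional null set may depend on the time. Rational times leave one null set, and
  continuity in time at each fixed x extends the bound to the others.\<close>

lemma AE_bounded_uniform:
  obtains R where "AE x in lebesgue. \<forall>t\<in>{0..T}. \<bar>u t x\<bar> \<le> R"
proof -
  \<comment> \<open>The extra unit of time leaves room for rational times that decrease to
    \<open>t\<close>, also when \<open>t = T\<close>.\<close>
  obtain R where R: "\<forall>t\<in>{0..T + 1}. AE x in lebesgue. \<bar>u t x\<bar> \<le> R"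
    using AE_bounded by blast
  have "countable (\<rat> \<inter> {0..T + 1})" by (intro countable_Int1 countable_rat)
  then have "AE x in lebesgue. \<forall>r\<in>\<rat> \<inter> {0..T + 1}. \<bar>u r x\<bar> \<le> R"
    using R by (subst AE_ball_countable) auto
  then have "AE x in lebesgue. \<forall>t\<in>{0..T}. \<bar>u t x\<bar> \<le> R"
  proof eventually_elim
    case (elim x)
    show ?case
    proof
      fix t assume t: "t \<in> {0..T}"
      have "\<exists>r\<in>\<rat>. t < r \<and> r < t + inverse (real (Suc n))" for n
        by (rule Rats_dense_in_real) simp
      then obtain r where r: "\<And>n. r n \<in> \<rat>" "\<And>n. t < r n" "\<And>n. r n < t + inverse (real (Suc n))"
        by metis
      have lim: "r \<longlonglongrightarrow> t"
      proof (rule tendsto_sandwich[OF _ _ tendsto_const])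
        show "(\<lambda>n. t + inverse (real (Suc n))) \<longlonglongrightarrow> t"
          using tendsto_add[OF tendsto_const LIMSEQ_inverse_real_of_nat, of t] by simp
      qed (use r in \<open>auto intro!: always_eventually less_imp_le\<close>)
      have "(\<lambda>n. u (r n) x) \<longlonglongrightarrow> u t x"
        using t r(2) by (intro continuous_on_tendsto_compose[OF continuous lim])
          (auto intro!: always_eventually less_imp_le order.strict_trans1[of 0 t])
      then have "(\<lambda>n. \<bar>u (r n) x\<bar>) \<longlonglongrightarrow> \<bar>u t x\<bar>" by (rule tendsto_rabs)
      moreover have "\<bar>u (r n) x\<bar> \<le> R" for n
      proof -
        have "inverse (real (Suc n)) \<le> 1" by (simp add: inverse_le_1_iff)
        then have "r n \<in> \<rat> \<inter> {0..T + 1}" using t r(1,2,3)[of n] by auto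
        with elim show ?thesis by blast
      qed
      ultimately show "\<bar>u t x\<bar> \<le> R" by (intro LIMSEQ_le_const2) auto
    qed
  qed
  then show ?thesis by (rule that)
qed

end

text \<open>Adding a spatial constant s to \<open>U\<close> does not change the nonlocal term, as
  \<open>K\<close> has mass 1. So \<open>dissipative\<close> is what makes
  \<open>U + q * exp (- \<mu> * t)\<close> a supersolution.\<close>

locale stable_from_above = pointwise_solution +
  fixes U :: "real \<Rightarrow> real" and q \<mu> S :: real
  assumes d: "0 \<le> d"
    and lipschitz: "\<exists>L. \<forall>v w. \<bar>v\<bar> \<le> R \<longrightarrow> \<bar>w\<bar> \<le> R \<longrightarrow> \<bar>f v - f w\<bar> \<le> L * \<bar>v - w\<bar>"
    and U_measurable: "U \<in> borel_measurable lebesgue" and U_bounded: "\<bar>U x\<bar> \<le> S"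
    and stationary: "rhs d f U x = 0"
    and q: "0 \<le> q" and \<mu>: "0 \<le> \<mu>"
    and dissipative: "0 \<le> s \<Longrightarrow> s \<le> q \<Longrightarrow> f (U x + s) - f (U x) \<le> - \<mu> * s"
    and initial: "u 0 x \<le> U x + q"
begin

abbreviation excess :: "real \<Rightarrow> real \<Rightarrow> real" where
  "excess t x \<equiv> u t x - U x - q * exp (- \<mu> * t)"

text \<open>The bound known almost everywhere enters at x only through the convolution, and the
  weight exp (- \<kappa> * t) makes that contribution small. The conclusion holds at this particular
  x, given a bound on \<open>u\<close> there, and not merely almost everywhere.\<close>

lemma excess_contraction:
  assumes A: "0 \<le> A" and AE: "\<And>t. t \<in> {0..T} \<Longrightarrow> AE y in lebesgue. excess t y \<le> A * exp (\<kappa> * t)"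
    and R: "\<And>t. t \<in> {0..T} \<Longrightarrow> \<bar>u t x\<bar> \<le> R" "S + q \<le> R"
    and L: "\<And>v w. \<bar>v\<bar> \<le> R \<Longrightarrow> \<bar>w\<bar> \<le> R \<Longrightarrow> \<bar>f v - f w\<bar> \<le> L * \<bar>v - w\<bar>"
    and \<kappa>: "L + 2 * d \<le> \<kappa>" and t: "t \<in> {0..T}"
  shows "excess t x \<le> A / 2 * exp (\<kappa> * t)"
proof -
  define y where "y s = excess s x * exp (- \<kappa> * s) - A / 2" for s
  have "y t \<le> 0"
  proof (rule nonpos_if_deriv_nonpos_where_pos[where y = y and t = t and T = T])
    show "continuous_on {0..T} y"
      unfolding y_def by (intro continuous_intros continuous_on_subset[OF continuous]) auto
    show "y 0 \<le> 0" using initial[of x] A by (simp add: y_def)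
    show "0 \<le> t" "t \<le> T" using t by auto
    fix s assume s: "0 < s" "s \<le> T" and pos: "0 < y s"
    define z e E where "z = excess s x" and "e = q * exp (- \<mu> * s)" and "E = exp (\<kappa> * s)"
    have E: "0 < E" "exp (- \<kappa> * s) = inverse E" by (simp_all add: E_def exp_minus)
    have z: "A / 2 * E < z"
      using pos E(1) unfolding y_def E(2) z_def by (simp add: field_simps)
    have "0 \<le> A / 2 * E" using A E by simp
    with z have z0: "0 \<le> z" by simp
    have e: "0 \<le> e" "e \<le> q"
      using q s \<mu> by (auto simp: e_def intro!: mult_left_le)
    have ueq: "u s x = U x + e + z" by (simp add: z_def e_def)
    let ?r = "rhs d f (u s) x"
    have conv_le: "conv K (u s) x \<le> conv K U x + (e + A * E)"
    proof -
      obtain R' where "AE y in lebesgue. \<bar>u s y\<bar> \<le> R'"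
        using AE_bounded[of s] s by (meson atLeastAtMost_iff less_imp_le order_refl)
      moreover have "AE y in lebesgue. u s y \<le> U y + (e + A * E)"
        using AE[of s] s by (auto simp: e_def E_def elim!: eventually_mono)
      ultimately show ?thesis
        using s by (intro conv_K_le_plus_const measurable U_measurable) (auto intro: U_bounded)
    qed
    have "f (u s x) - f (U x + e) \<le> L * z"
    proof -
      have "\<bar>u s x\<bar> \<le> R" using R(1)[of s] s by simp
      moreover have "\<bar>U x + e\<bar> \<le> R" using U_bounded[of x] e R(2) by linarith
      ultimately have "\<bar>f (u s x) - f (U x + e)\<bar> \<le> L * \<bar>u s x - (U x + e)\<bar>" by (rule L)
      also have "\<bar>u s x - (U x + e)\<bar> = z" using ueq z0 by simp
      finally show ?thesis by simp
    qed
    moreover have "f (U x + e) - f (U x) \<le> - \<mu> * e" by (rule dissipative[OF e])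
    moreover have "?r - rhs d f U x = d * (conv K (u s) x - conv K U x - e - z) + f (u s x) - f (U x)"
      by (simp add: rhs_def ueq algebra_simps)
    moreover have "d * (conv K (u s) x - conv K U x - e - z) \<le> d * (A * E - z)"
      using d conv_le by (intro mult_left_mono) auto
    ultimately have r: "?r + \<mu> * e \<le> d * (A * E - z) + L * z"
      using stationary[of x] by simp
    \<comment> \<open>Positivity of \<open>y\<close> means that the excess \<open>z\<close> is above
      half the bound, so the nonlocal term is below \<open>2 * d * z\<close>. Together with the
      local growth \<open>L * z\<close> it is absorbed by \<open>\<kappa> * z\<close>; this is the
      origin of \<open>L + 2 * d\<close>.\<close>
    have "d * (A * E) \<le> d * (2 * z)" using d z by (intro mult_left_mono) auto
    moreover have "(L + 2 * d) * z \<le> \<kappa> * z" using z0 \<kappa> by (intro mult_right_mono)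
    moreover have "0 \<le> d * z" using d z0 by simp
    ultimately have "?r + \<mu> * e - \<kappa> * z \<le> 0" using r by (simp add: algebra_simps)
    then have "(?r + \<mu> * e - \<kappa> * z) * exp (- \<kappa> * s) \<le> 0"
      by (simp add: mult_nonpos_nonneg)
    moreover have "(y has_real_derivative (?r + \<mu> * e - \<kappa> * z) * exp (- \<kappa> * s)) (at s)"
      unfolding y_def[abs_def] e_def z_def
      by (auto intro!: derivative_eq_intros ode[OF s(1)] simp: algebra_simps)
    ultimately show "\<exists>D\<le>0. (y has_real_derivative D) (at s)" by blast
  qed
  then show ?thesis by (simp add: y_def exp_minus field_simps)
qed

text \<open>Repeated halving from a crude bound. \<open>R\<close>, \<open>L\<close> and \<kappa> are
  fixed for the whole time interval beforehand, so the rate does not deteriorate with n.\<close>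

lemma AE_excess_le:
  obtains \<kappa> A where "0 \<le> A"
    "\<And>n t. t \<in> {0..T} \<Longrightarrow> AE x in lebesgue. excess t x \<le> A / 2 ^ n * exp (\<kappa> * t)"
proof -
  obtain R0 where R0: "AE x in lebesgue. \<forall>t\<in>{0..T}. \<bar>u t x\<bar> \<le> R0"
    by (rule AE_bounded_uniform)
  define R where "R = \<bar>R0\<bar> + \<bar>S\<bar> + q"
  have R: "AE x in lebesgue. \<forall>t\<in>{0..T}. \<bar>u t x\<bar> \<le> R" "S + q \<le> R"
    using R0 q by (auto simp: R_def elim!: eventually_mono)
  obtain L where L: "\<And>v w. \<bar>v\<bar> \<le> R \<Longrightarrow> \<bar>w\<bar> \<le> R \<Longrightarrow> \<bar>f v - f w\<bar> \<le> L * \<bar>v - w\<bar>"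
    using lipschitz[of R] by blast
  define \<kappa> where "\<kappa> = \<bar>L\<bar> + 2 * d"
  have \<kappa>: "0 \<le> \<kappa>" "L + 2 * d \<le> \<kappa>" using d by (simp_all add: \<kappa>_def)
  define A where "A = R + \<bar>S\<bar>"
  have A: "0 \<le> A" using q by (simp add: A_def R_def)
  have "AE x in lebesgue. excess t x \<le> A / 2 ^ n * exp (\<kappa> * t)" if "t \<in> {0..T}" for n t
    using that
  proof (induction n arbitrary: t)
    case 0
    show ?case using R(1)
    proof eventually_elim
      case (elim x)
      have "0 \<le> q * exp (- \<mu> * t)" using q by simp
      moreover have "u t x \<le> R" "- U x \<le> \<bar>S\<bar>" using elim 0 U_bounded[of x] by fastforce+
      moreover have "A \<le> A * exp (\<kappa> * t)" using A 0 \<kappa> by (simp add: mult_le_cancel_left1)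
      ultimately show ?case unfolding A_def by simp
    qed
  next
    case (Suc n)
    show ?case using R(1)
    proof eventually_elim
      case (elim x)
      have "excess t x \<le> A / 2 ^ n / 2 * exp (\<kappa> * t)"
        by (rule excess_contraction[where R = R and L = L and T = T])
          (use A Suc elim R(2) L \<kappa> in auto)
      then show ?case by (simp add: field_simps)
    qed
  qed
  with A show ?thesis by (rule that)
qed

theorem le_stationary_plus_exp:
  assumes t: "0 \<le> t"
  shows "u t x \<le> U x + q * exp (- \<mu> * t)"
proof -
  obtain \<kappa> A where A: "0 \<le> A"
    "\<And>n s. s \<in> {0..t} \<Longrightarrow> AE y in lebesgue. excess s y \<le> A / 2 ^ n * exp (\<kappa> * s)"
    using AE_excess_le[where T = t] by metis
  \<comment> \<open>A bound by 0 holds for every rate. The final contraction can therefore use a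
    Lipschitz constant adapted to the given x, which may belong to the exceptional null set.\<close>
  have AE0: "AE y in lebesgue. excess s y \<le> 0 * exp (\<kappa>' * s)" if s: "s \<in> {0..t}" for s \<kappa>'
  proof -
    have "AE y in lebesgue. \<forall>n. excess s y \<le> A / 2 ^ n * exp (\<kappa> * s)"
      using A(2)[OF s] by (simp add: AE_all_countable)
    then show ?thesis
    proof eventually_elim
      case (elim y)
      have "(\<lambda>n. A / 2 ^ n * exp (\<kappa> * s)) \<longlonglongrightarrow> 0" by real_asymp
      then show ?case using elim by (intro LIMSEQ_le_const) auto
    qed
  qed
  have "bounded ((\<lambda>s. u s x) ` {0..t})"
    by (intro compact_imp_bounded compact_continuous_image continuous_on_subset[OF continuous]) auto
  then obtain R0 where R0: "\<And>s. s \<in> {0..t} \<Longrightarrow> \<bar>u s x\<bar> \<le> R0"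
    by (metis bounded_iff image_eqI real_norm_def)
  define R where "R = \<bar>R0\<bar> + \<bar>S\<bar> + q"
  obtain L where L: "\<And>v w. \<bar>v\<bar> \<le> R \<Longrightarrow> \<bar>w\<bar> \<le> R \<Longrightarrow> \<bar>f v - f w\<bar> \<le> L * \<bar>v - w\<bar>"
    using lipschitz[of R] by blast
  have "excess t x \<le> 0 / 2 * exp ((L + 2 * d) * t)"
  proof (rule excess_contraction[where R = R and L = L and T = t])
    show "\<bar>u s x\<bar> \<le> R" if "s \<in> {0..t}" for s using R0[OF that] q by (simp add: R_def)
  qed (use AE0 L t q in \<open>auto simp: R_def\<close>)
  then show ?thesis by simp
qed

end

section \<open>From the norm of the solution space to bounds almost everywhere\<close>

lemma L1Linf_AE_le:
  assumes "L1Linf_norm v \<le> ennreal r" "0 \<le> r"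
  shows "AE x in lebesgue. \<bar>v x\<bar> \<le> r"
proof -
  have le: "esssup lebesgue (\<lambda>x. ennreal \<bar>v x\<bar>) \<le> ennreal r"
    using assms(1) unfolding L1Linf_norm_def by (rule order_trans[rotated]) simp
  from esssup_AE[of "\<lambda>x. ennreal \<bar>v x\<bar>" lebesgue] show ?thesis
  proof eventually_elim
    case (elim x)
    then have "ennreal \<bar>v x\<bar> \<le> ennreal r" using le by (rule order_trans)
    then show ?case by (simp add: assms(2))
  qed
qed

text \<open>Continuity in norm bounds \<open>u\<close> near each time, and bisection joins the local
  bounds over the compact interval.\<close>

lemma C0_L1Linf_AE_bounded:
  assumes u: "C0_L1Linf {0..} u"
  shows "\<exists>R. \<forall>t\<in>{0..T}. AE x in lebesgue. \<bar>u t x\<bar> \<le> R"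
proof (cases "0 \<le> T")
  case True
  define P where "P a b \<longleftrightarrow> (\<exists>R. \<forall>t. a \<le> t \<longrightarrow> t \<le> b \<longrightarrow> 0 \<le> t \<longrightarrow> (AE x in lebesgue. \<bar>u t x\<bar> \<le> R))"
    for a b
  have "P 0 T"
  proof (rule Bolzano[where P = P, OF True])
    fix a b c assume "P a b" "P b c"
    then obtain R1 R2 where R:
      "\<And>t. a \<le> t \<Longrightarrow> t \<le> b \<Longrightarrow> 0 \<le> t \<Longrightarrow> AE x in lebesgue. \<bar>u t x\<bar> \<le> R1"
      "\<And>t. b \<le> t \<Longrightarrow> t \<le> c \<Longrightarrow> 0 \<le> t \<Longrightarrow> AE x in lebesgue. \<bar>u t x\<bar> \<le> R2"
      unfolding P_def by blast
    have "AE x in lebesgue. \<bar>u t x\<bar> \<le> max R1 R2" if "a \<le> t" "t \<le> c" "0 \<le> t" for t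
    proof (cases "t \<le> b")
      case True
      show ?thesis using R(1)[OF that(1) True that(3)] by eventually_elim simp
    next
      case False
      show ?thesis using R(2)[OF _ that(2,3)] False by (auto elim!: eventually_mono)
    qed
    then show "P a c" unfolding P_def by blast
  next
    fix s assume s: "0 \<le> s" "s \<le> T"
    have "L1Linf_norm (u s) < \<infinity>" using u s by (auto simp: C0_L1Linf_def L1Linf_def)
    then obtain r where r: "0 \<le> r" "L1Linf_norm (u s) = ennreal r"
      by (cases "L1Linf_norm (u s)") auto
    then have AEs: "AE x in lebesgue. \<bar>u s x\<bar> \<le> r" by (intro L1Linf_AE_le) auto
    have "((\<lambda>s'. L1Linf_norm (\<lambda>x. u s' x - u s x)) \<longlongrightarrow> 0) (at s within {0..})"
      using u s by (auto simp: C0_L1Linf_def)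
    then have "\<forall>\<^sub>F s' in at s within {0..}. L1Linf_norm (\<lambda>x. u s' x - u s x) < 1"
      by (rule order_tendstoD) simp
    then obtain \<delta> where \<delta>: "0 < \<delta>"
      "\<And>t. 0 \<le> t \<Longrightarrow> t \<noteq> s \<Longrightarrow> \<bar>t - s\<bar> < \<delta> \<Longrightarrow> L1Linf_norm (\<lambda>x. u t x - u s x) < 1"
      by (auto simp: eventually_at dist_real_def)
    have near: "AE x in lebesgue. \<bar>u t x\<bar> \<le> r + 1" if t: "0 \<le> t" "\<bar>t - s\<bar> < \<delta>" for t
    proof (cases "t = s")
      case True
      with AEs show ?thesis by (auto elim!: eventually_mono)
    next
      case False
      then have "L1Linf_norm (\<lambda>x. u t x - u s x) \<le> ennreal 1"
        using \<delta>(2)[OF t(1) _ t(2)] by (simp add: less_imp_le)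
      then have "AE x in lebesgue. \<bar>u t x - u s x\<bar> \<le> 1" by (rule L1Linf_AE_le) simp
      with AEs show ?thesis by eventually_elim auto
    qed
    have "P a b" if "a \<le> s" "s \<le> b" "b - a < \<delta>" for a b
      unfolding P_def
      by (intro exI[of _ "r + 1"] allI impI near) (use that in auto)
    with \<delta>(1) show "\<exists>\<delta>>0. \<forall>a b. a \<le> s \<and> s \<le> b \<and> b - a < \<delta> \<longrightarrow> P a b" by blast
  qed
  then show ?thesis unfolding P_def by (meson atLeastAtMost_iff)
qed auto

lemma cauchy_solution_pointwise:
  assumes "cauchy_solution d f u0 u"
  shows "pointwise_solution d f u"
proof
  have C0: "C0_L1Linf {0..} u" using assms by (simp add: cauchy_solution_def)
  show "u t \<in> borel_measurable lebesgue" if "0 \<le> t" for t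
    using C0 that by (auto simp: C0_L1Linf_def L1Linf_def)
  show "\<exists>R. \<forall>t\<in>{0..T}. AE x in lebesgue. \<bar>u t x\<bar> \<le> R" for T
    by (rule C0_L1Linf_AE_bounded[OF C0])
qed (use assms in \<open>auto simp: cauchy_solution_def\<close>)

lemma conv_minus: "conv k (\<lambda>y. - v y) x = - conv k v x"
  by (simp add: conv_def)

text \<open>If u solves the equation, \<open>- u\<close> solves it with \<open>f\<close> replaced by
  its odd reflection. A lower barrier for u thus becomes an upper barrier for \<open>- u\<close>,
  and one comparison theorem serves both sides.\<close>

lemma rhs_minus: "rhs d (\<lambda>v. - f (- v)) (\<lambda>y. - v y) x = - rhs d f v x"
  by (simp add: rhs_def conv_minus algebra_simps)

lemma (in pointwise_solution) pointwise_solution_minus: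
  "pointwise_solution d (\<lambda>v. - f (- v)) (\<lambda>t x. - u t x)"
proof
  show "\<exists>R. \<forall>t\<in>{0..T}. AE x in lebesgue. \<bar>- u t x\<bar> \<le> R" for T
    using AE_bounded by simp
  show "continuous_on {0..} (\<lambda>t. - u t x)" for x
    by (intro continuous_on_minus continuous)
  show "((\<lambda>s. - u s x) has_real_derivative rhs d (\<lambda>v. - f (- v)) (\<lambda>x. - u t x) x) (at t)" if "0 < t" for t x
    unfolding rhs_minus by (intro DERIV_minus ode that)
qed (use measurable in auto)

subsection \<open>Inverse branches and stability of ground states\<close>

lemma K_mass_tendsto_1: "(\<lambda>n. LINT y|lborel. K y * indicator {- real n..real n} y) \<longlonglongrightarrow> 1"
proof -
  have "(\<lambda>n. LINT y|lborel. K y * indicator {- real n..real n} y) \<longlonglongrightarrow> (LINT y|lborel. K y)"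
  proof (rule integral_dominated_convergence[where w = K])
    show "integrable lborel K" using has_bochner_integral_K by (simp add: has_bochner_integral_iff)
    show "AE y in lborel. norm (K y * indicator {- real n..real n} y) \<le> K y" for n
      by (auto simp: indicator_def K_nonneg)
    show "AE y in lborel. (\<lambda>n. K y * indicator {- real n..real n} y) \<longlonglongrightarrow> K y"
    proof (intro AE_I2 tendsto_eventually eventually_sequentiallyI)
      fix y :: real and n assume "nat \<lceil>\<bar>y\<bar>\<rceil> \<le> n"
      then have "\<bar>y\<bar> \<le> real n" by linarith
      then show "K y * indicator {- real n..real n} y = K y" by (simp add: indicator_def abs_le_iff)
    qed
  qed measurable
  then show ?thesis using has_bochner_integral_K by (simp add: has_bochner_integral_iff)
qed

text \<open>Compactness gives a gap \<open>2 * \<delta>\<close> between \<open>h v\<close> and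
  \<open>v\<close>. The radius is chosen so that truncation loses less than \<delta> of the kernel's
  mass; since \<open>h \<le> 1\<close>, this costs at most half of the gap.\<close>

lemma uniform_gain:
  assumes h: "continuous_on UNIV h" and h1: "\<And>v. h v \<le> 1" and m: "0 \<le> m"
    and gain: "\<And>v. 0 \<le> v \<Longrightarrow> v \<le> m \<Longrightarrow> v < h v"
  obtains R \<delta> where "0 < R" "0 < \<delta>"
    "\<And>v. 0 \<le> v \<Longrightarrow> v \<le> m \<Longrightarrow> v + \<delta> \<le> (LINT y|lborel. K y * indicator {-R..R} y) * h v"
proof -
  have "continuous_on {0..m} (\<lambda>v. h v - v)"
    by (intro continuous_intros continuous_on_subset[OF h]) auto
  then obtain w where w: "w \<in> {0..m}" "\<And>v. v \<in> {0..m} \<Longrightarrow> h w - w \<le> h v - v"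
    using continuous_attains_inf[of "{0..m}" "\<lambda>v. h v - v"] m by auto
  define \<delta> where "\<delta> = (h w - w) / 2"
  have \<delta>: "0 < \<delta>" using gain[of w] w(1) by (simp add: \<delta>_def)
  have "\<forall>\<^sub>F n in sequentially. 1 - \<delta> < (LINT y|lborel. K y * indicator {- real n..real n} y)"
    by (rule order_tendstoD(1)[OF K_mass_tendsto_1]) (use \<delta> in simp)
  then have "\<forall>\<^sub>F n in sequentially. 1 - \<delta> < (LINT y|lborel. K y * indicator {- real n..real n} y) \<and> 0 < n"
    using eventually_gt_at_top[of 0] by eventually_elim simp
  then obtain n where n: "1 - \<delta> < (LINT y|lborel. K y * indicator {- real n..real n} y)" "0 < n"
    by (auto dest!: eventually_happens)
  show ?thesis
  proof (rule that[of "real n" \<delta>])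
    fix v assume v: "0 \<le> v" "v \<le> m"
    have hv: "0 \<le> h v" "v + 2 * \<delta> \<le> h v" using gain[OF v] v w(2)[of v] by (auto simp: \<delta>_def diff_divide_distrib)
    have "\<delta> * h v \<le> \<delta>" using \<delta> h1[of v] by (simp add: mult_left_le)
    then have "v + \<delta> \<le> (1 - \<delta>) * h v" using hv by (simp add: algebra_simps)
    also have "\<dots> \<le> (LINT y|lborel. K y * indicator {- real n..real n} y) * h v"
      using n hv by (intro mult_right_mono) auto
    finally show "v + \<delta> \<le> (LINT y|lborel. K y * indicator {- real n..real n} y) * h v" .
  qed (use n \<delta> in auto)
qed

section \<open>Monotone continuous extensions of the inverse branches\<close>

definition clamp_inv :: "(real \<Rightarrow> real) \<Rightarrow> real \<Rightarrow> real \<Rightarrow> real \<Rightarrow> real \<Rightarrow> real" where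
  "clamp_inv g p q b v = inv_into {p..q} g (max 0 (min v b))"

locale increasing_branch =
  fixes g :: "real \<Rightarrow> real" and p q b :: real
  assumes g_cont: "continuous_on {p..q} g"
    and g_strict: "strict_mono_on {p..q} g"
    and pq: "p \<le> q" and b: "0 \<le> b" and range: "g p \<le> 0" "b \<le> g q"
begin

abbreviation h :: "real \<Rightarrow> real" where "h \<equiv> clamp_inv g p q b"

lemma inj: "inj_on g {p..q}"
  using g_strict by (rule strict_mono_on_imp_inj_on)

lemma clamp_in_image: "max 0 (min v b) \<in> g ` {p..q}"
proof -
  have "\<exists>x\<ge>p. x \<le> q \<and> g x = max 0 (min v b)"
    using range b pq g_cont by (intro IVT') auto
  then show ?thesis by force
qed

lemma h_mem: "h v \<in> {p..q}" and g_h: "g (h v) = max 0 (min v b)"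
  unfolding clamp_inv_def
  by (rule inv_into_into[OF clamp_in_image], rule f_inv_into_f[OF clamp_in_image])

lemma h_mono: "mono h"
proof
  fix v w :: real assume "v \<le> w"
  then have "g (h v) \<le> g (h w)" by (simp add: g_h)
  then show "h v \<le> h w"
    using g_strict h_mem[of v] h_mem[of w] by (meson linorder_not_le strict_mono_onD)
qed

lemma h_cont: "continuous_on UNIV h"
proof -
  have "continuous_on (g ` {p..q}) (inv_into {p..q} g)"
    by (rule continuous_on_inv[OF g_cont]) (auto intro: inv_into_f_f inj)
  then show ?thesis
    unfolding clamp_inv_def[abs_def]
    by (rule continuous_on_compose2) (auto intro!: continuous_intros clamp_in_image)
qed

lemma h_less_iff:
  assumes "x \<in> {p..q}"
  shows "x < h v \<longleftrightarrow> g x < max 0 (min v b)" "h v < x \<longleftrightarrow> max 0 (min v b) < g x"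
  using strict_mono_on_less[OF g_strict assms h_mem[of v]] strict_mono_on_less[OF g_strict h_mem[of v] assms]
  by (simp_all add: g_h)

lemma h_eq: "0 \<le> v \<Longrightarrow> v \<le> b \<Longrightarrow> h v = inv_into {p..q} g v"
  by (simp add: clamp_inv_def)

end

text \<open>With \<mu> half the distance of the maximum on \<open>A\<close> from 0, the open set
  where \<open>\<phi> < - \<mu>\<close> contains a uniform neighbourhood of the compact set
  \<open>A\<close>.\<close>

lemma negative_near_compact:
  fixes \<phi> :: "real \<Rightarrow> real"
  assumes \<phi>: "continuous_on UNIV \<phi>" and neg: "\<And>w. w \<in> A \<Longrightarrow> \<phi> w < 0" and A: "compact A" "A \<noteq> {}"
  obtains \<mu> \<eta> where "0 < \<mu>" "0 < \<eta>" "\<And>w s. w \<in> A \<Longrightarrow> \<bar>s\<bar> \<le> \<eta> \<Longrightarrow> \<phi> (w + s) \<le> - \<mu>"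
proof -
  obtain z where z: "z \<in> A" "\<And>w. w \<in> A \<Longrightarrow> \<phi> w \<le> \<phi> z"
    using continuous_attains_sup[OF A continuous_on_subset[OF \<phi>]] by auto
  define \<mu> where "\<mu> = - \<phi> z / 2"
  have \<mu>: "0 < \<mu>" using neg[OF z(1)] by (simp add: \<mu>_def)
  have "open {w. \<phi> w < - \<mu>}" using \<phi> by (intro open_Collect_less) auto
  moreover have "A \<subseteq> {w. \<phi> w < - \<mu>}" using z(2) neg[OF z(1)] by (fastforce simp: \<mu>_def)
  ultimately obtain e where e: "0 < e" "(\<Union>x\<in>A. ball x e) \<subseteq> {w. \<phi> w < - \<mu>}"
    using compact_subset_open_imp_ball_epsilon_subset[OF A(1)] by blast
  show ?thesis
  proof (rule that[of \<mu> "e / 2"])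
    fix w s assume "w \<in> A" "\<bar>s\<bar> \<le> e / 2"
    then have "w + s \<in> (\<Union>x\<in>A. ball x e)" using e(1) by (auto intro!: bexI[of _ w] simp: dist_real_def)
    with e(2) have "w + s \<in> {w. \<phi> w < - \<mu>}" by (rule subsetD)
    then show "\<phi> (w + s) \<le> - \<mu>" by simp
  qed (use \<mu> e in auto)
qed

lemma decrement_le:
  fixes f :: "real \<Rightarrow> real"
  assumes der: "\<And>x. (f has_real_derivative f' x) (at x)"
    and le: "\<And>z. w \<le> z \<Longrightarrow> z \<le> w + s \<Longrightarrow> f' z \<le> - \<mu>" and s: "0 \<le> s"
  shows "f (w + s) - f w \<le> - \<mu> * s"
proof -
  have "f (w + s) + \<mu> * (w + s) \<le> f w + \<mu> * w"
  proof (rule DERIV_nonpos_imp_nonincreasing[of w "w + s" "\<lambda>z. f z + \<mu> * z"])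
    fix z assume "w \<le> z" "z \<le> w + s"
    then have "f' z + \<mu> \<le> 0" using le by fastforce
    moreover have "((\<lambda>z. f z + \<mu> * z) has_real_derivative f' z + \<mu>) (at z)"
      by (auto intro!: derivative_eq_intros der)
    ultimately show "\<exists>y. ((\<lambda>z. f z + \<mu> * z) has_real_derivative y) (at z) \<and> y \<le> 0" by blast
  qed (use s in simp)
  then show ?thesis by (simp add: algebra_simps)
qed

lemma locally_lipschitz_of_C1:
  fixes f :: "real \<Rightarrow> real"
  assumes der: "\<And>x. (f has_real_derivative f' x) (at x)" and cont: "continuous_on UNIV f'"
  shows "\<exists>L. \<forall>v w. \<bar>v\<bar> \<le> R \<longrightarrow> \<bar>w\<bar> \<le> R \<longrightarrow> \<bar>f v - f w\<bar> \<le> L * \<bar>v - w\<bar>"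
proof -
  have "bounded (f' ` {-R..R})"
    by (intro compact_imp_bounded compact_continuous_image continuous_on_subset[OF cont]) auto
  then obtain L where L: "\<And>x. x \<in> {-R..R} \<Longrightarrow> \<bar>f' x\<bar> \<le> L"
    by (metis bounded_iff image_eqI real_norm_def)
  have "norm (f v - f w) \<le> L * norm (v - w)" if "\<bar>v\<bar> \<le> R" "\<bar>w\<bar> \<le> R" for v w
    using that L
    by (intro field_differentiable_bound[where S = "{-R..R}" and f' = f'])
      (auto intro: has_field_derivative_at_within der)
  then show ?thesis by auto
qed

lemma smooth_deriv:
  assumes "smooth f"
  shows "(f has_real_derivative deriv f x) (at x)" "continuous_on UNIV (deriv f)"
proof -
  have "(deriv ^^ 0) f differentiable (at x)" using assms unfolding smooth_def by blast
  then show "(f has_real_derivative deriv f x) (at x)"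
    by (simp add: DERIV_deriv_iff_real_differentiable)
  have "deriv f differentiable (at z)" for z
    using assms[unfolded smooth_def, rule_format, of 1 z] by simp
  then show "continuous_on UNIV (deriv f)"
    by (intro continuous_at_imp_continuous_on ballI differentiable_imp_continuous_within)
qed

section \<open>The branches of the bistable nonlinearity\<close>

locale bistable =
  fixes d a \<beta> \<gamma> v_c u_plus u_minus :: real
    and f g :: "real \<Rightarrow> real"
  assumes d: "d > 0"
    and f_smooth: "smooth f"
    and a: "0 < a" "a < 1"
    and f_zeros: "f 0 = 0" "f a = 0" "f 1 = 0"
    and f_neg: "\<forall>u\<in>{0<..<a}. f u < 0"
    and f_pos: "\<forall>u\<in>{a<..<1}. f u > 0"
    and f_deriv: "deriv f 0 < 0"
    and g: "\<forall>u. g u = u - f u / d"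
    and \<beta>\<gamma>: "0 < \<beta>" "\<beta> < \<gamma>" "\<gamma> < 1"
    and g_incr: "\<forall>u\<in>{0..<\<beta>} \<union> {\<gamma><..1}. deriv g u > 0"
    and v_c: "v_c \<in> {0<..g \<beta>} \<inter> {g \<gamma>..<1}"
    and v_c_eq: "G_plus g \<gamma> v_c - G_minus g \<beta> v_c = G_plus g \<gamma> 1"
    and u_plus: "u_plus \<in> {\<gamma><..<1}" "\<forall>u\<in>{u_plus<..1}. deriv f u < 0"
    and u_minus: "u_minus \<in> {0<..<\<beta>}" "\<forall>u\<in>{0..<u_minus}. deriv f u < 0"
    and order: "g u_plus < 0" "v_c < g u_minus"
begin

lemma f_has_deriv: "(f has_real_derivative deriv f u) (at u)"
  by (rule smooth_deriv(1)[OF f_smooth])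

lemma g_has_deriv: "(g has_real_derivative deriv g u) (at u)"
proof -
  have "g = (\<lambda>u. u - f u / d)" using g by auto
  moreover have "((\<lambda>u. u - f u / d) has_real_derivative 1 - deriv f u / d) (at u)"
    by (intro DERIV_diff DERIV_ident DERIV_cdivide f_has_deriv)
  ultimately have "(g has_real_derivative 1 - deriv f u / d) (at u)" by simp
  then show ?thesis by (simp add: DERIV_imp_deriv)
qed

lemma g_continuous: "continuous_on S g"
  using g_has_deriv by (intro continuous_at_imp_continuous_on ballI DERIV_isCont)

lemma g_strict_mono_on:
  assumes "{p<..<q} \<subseteq> {0..<\<beta>} \<union> {\<gamma><..1}"
  shows "strict_mono_on {p..q} g"
proof (rule strict_mono_onI)
  fix r s assume rs: "r \<in> {p..q}" "s \<in> {p..q}" "r < s"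
  show "g r < g s"
  proof (rule DERIV_pos_imp_increasing_open[OF rs(3)])
    fix x assume "r < x" "x < s"
    then have "x \<in> {p<..<q}" using rs by auto
    with assms have "x \<in> {0..<\<beta>} \<union> {\<gamma><..1}" by (rule subsetD)
    then have "0 < deriv g x" using g_incr by blast
    then show "\<exists>y. (g has_real_derivative y) (at x) \<and> 0 < y" using g_has_deriv by blast
  qed (rule g_continuous)
qed

lemma g_0: "g 0 = 0" and g_1: "g 1 = 1"
  using g f_zeros by simp_all

lemma f_eq: "f u = d * (u - g u)"
  using g d by (simp add: field_simps)

sublocale minus: increasing_branch g 0 \<beta> "g u_minus"
proof
  show strict: "strict_mono_on {0..\<beta>} g" by (rule g_strict_mono_on) auto
  show "g u_minus \<le> g \<beta>"
    using strict_mono_onD[OF strict, of u_minus \<beta>] u_minus by auto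
qed (use g_continuous \<beta>\<gamma> order v_c g_0 in auto)

sublocale plus: increasing_branch g \<gamma> 1 1
proof
  show strict: "strict_mono_on {\<gamma>..1} g" by (rule g_strict_mono_on) auto
  show "g \<gamma> \<le> 0"
    using strict_mono_onD[OF strict, of \<gamma> u_plus] u_plus order by auto
qed (use g_continuous \<beta>\<gamma> g_1 in auto)

abbreviation hm :: "real \<Rightarrow> real" where "hm \<equiv> minus.h"
abbreviation hp :: "real \<Rightarrow> real" where "hp \<equiv> plus.h"

text \<open>A negative \<open>g \<gamma>\<close> forces
  \<open>f \<gamma> = d * (\<gamma> - g \<gamma>) > 0\<close>, whereas \<open>f\<close> is not
  positive on \<open>{0..a}\<close>.\<close>

lemma a_less_hp: "a < hp v"
proof -
  have "g \<gamma> < 0"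
    using strict_mono_onD[OF plus.g_strict, of \<gamma> u_plus] u_plus order by auto
  then have "0 < f \<gamma>" using f_eq[of \<gamma>] \<beta>\<gamma> d by simp
  then have "a < \<gamma>"
    using f_neg f_zeros \<beta>\<gamma> by (metis greaterThanLessThan_iff linorder_neqE_linordered_idom order.strict_trans less_irrefl)
  then show ?thesis using plus.h_mem[of v] by simp
qed

lemma u_plus_less_hp: "u_plus < hp v"
  using plus.h_less_iff(1)[of u_plus v] u_plus order by auto

text \<open>\<open>f (hp v) = d * (hp v - v)\<close>, so the claim is the positivity of
  \<open>f\<close> between \<open>a\<close> and 1.\<close>

lemma less_hp:
  assumes v: "0 \<le> v" "v < 1"
  shows "v < hp v"
proof -
  have "hp v < 1" using plus.h_less_iff(2)[of 1 v] v g_1 \<beta>\<gamma> by simp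
  then have "0 < f (hp v)" using f_pos a_less_hp by simp
  moreover have "g (hp v) = v" using v by (simp add: plus.g_h)
  ultimately show ?thesis using f_eq[of "hp v"] d by (simp add: zero_less_mult_iff)
qed

lemma hp_1: "hp 1 = 1"
proof -
  have "\<not> hp 1 < 1" using plus.h_less_iff(2)[of 1 1] g_1 \<beta>\<gamma> by simp
  then show ?thesis using plus.h_mem[of 1] by simp
qed

lemma hm_le_u_minus: "hm v \<le> u_minus"
  using minus.h_less_iff(1)[of u_minus v] u_minus minus.b by fastforce

lemma hm_pos: "0 < v \<Longrightarrow> 0 < hm v"
  using minus.h_less_iff(1)[of 0 v] \<beta>\<gamma> g_0 order v_c by auto

lemma f_le_linear:
  obtains c where "0 < c" "\<And>u. 0 \<le> u \<Longrightarrow> u \<le> u_minus \<Longrightarrow> f u \<le> - c * u"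
proof -
  have um: "0 < u_minus" using u_minus by simp
  define c1 where "c1 = - deriv f 0 / 2"
  have c1: "0 < c1" using f_deriv by (simp add: c1_def)
  have "((\<lambda>u. (f u - f 0) / (u - 0)) \<longlongrightarrow> deriv f 0) (at 0)"
    using f_has_deriv[of 0] by (simp add: has_field_derivative_iff)
  then have "\<forall>\<^sub>F u in at 0. f u / u < - c1"
    using f_deriv f_zeros by (intro order_tendstoD(2)[of _ "deriv f 0"]) (auto simp: c1_def)
  then obtain e where e: "0 < e" "\<And>u. u \<noteq> 0 \<Longrightarrow> \<bar>u\<bar> < e \<Longrightarrow> f u / u < - c1"
    by (auto simp: eventually_at dist_real_def)
  define r where "r = min (e / 2) u_minus"
  have r: "0 < r" "r < e" "r \<le> u_minus" using e um by (auto simp: r_def min_def)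
  have small: "f u \<le> - c1 * u" if "0 \<le> u" "u < e" for u
  proof (cases "u = 0")
    case False
    then show ?thesis using e(2)[of u] that by (simp add: divide_less_eq split: if_splits)
  qed (simp add: f_zeros)
  \<comment> \<open>Scaled so that \<open>- c * u\<close> falls to \<open>- c1 * r\<close> only at
    \<open>u_minus\<close>: from \<open>r\<close> on, \<open>f\<close> stays below
    \<open>- c1 * r\<close> by monotonicity.\<close>
  define c where "c = c1 * r / u_minus"
  have c: "0 < c" "c \<le> c1" using c1 r um by (simp_all add: c_def field_simps)
  have "f u \<le> - c * u" if u: "0 \<le> u" "u \<le> u_minus" for u
  proof (cases "u < e")
    case True
    have "c * u \<le> c1 * u" using c u by (intro mult_right_mono) auto
    then show ?thesis using small[OF u(1) True] by simp
  next
    case False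
    have "f u \<le> f r"
    proof (rule DERIV_nonpos_imp_decreasing_open[of r u f])
      show "r \<le> u" using False r by simp
      show "\<exists>y. (f has_real_derivative y) (at x) \<and> y \<le> 0" if "r < x" "x < u" for x
        using f_has_deriv[of x] u_minus(2) that r u by (intro exI[of _ "deriv f x"]) (auto intro: less_imp_le)
      show "continuous_on {r..u} f"
        by (intro continuous_at_imp_continuous_on ballI DERIV_isCont[OF f_has_deriv])
    qed
    also have "\<dots> \<le> - c1 * r" using r by (intro small) auto
    also have "\<dots> \<le> - c * u"
    proof -
      have "c1 * r * u \<le> c1 * r * u_minus" using u c1 r by (intro mult_left_mono) auto
      then show ?thesis using um by (simp add: c_def field_simps)
    qed
    finally show ?thesis .
  qed
  with c(1) show ?thesis by (rule that)
qed

text \<open>\<open>d * g u = d * u - f u \<ge> (d + c) * u\<close> on \<open>{0..u_minus}\<close>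
  bounds the lower inverse by a linear function. The factor does not depend on \<open>x0\<close>, so
  \<open>x0\<close> can later be chosen in terms of it.\<close>

lemma pinned_exists: "\<exists>\<theta>. \<forall>x0>0. pinned hp hm \<theta> x0"
proof -
  obtain c where c: "0 < c" "\<And>u. 0 \<le> u \<Longrightarrow> u \<le> u_minus \<Longrightarrow> f u \<le> - c * u"
    using f_le_linear by metis
  define \<theta> where "\<theta> = d / (d + c)"
  have \<theta>: "0 \<le> \<theta>" "\<theta> < 1" using c d by (auto simp: \<theta>_def field_simps)
  have "pinned hp hm \<theta> x0" if "0 < x0" for x0
  proof
    fix v w :: real
    show "0 < hp v" "hp v \<le> 1" using plus.h_mem[of v] \<beta>\<gamma> by auto
    show "0 \<le> hm v" using minus.h_mem[of v] by auto
    show "hm v < hp w" using minus.h_mem[of v] plus.h_mem[of w] \<beta>\<gamma> by auto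
    show "hm v \<le> \<theta> * v" if v: "0 \<le> v"
    proof -
      have "f (hm v) \<le> - c * hm v"
        using minus.h_mem[of v] by (intro c hm_le_u_minus) auto
      then have "(d + c) * hm v \<le> d * g (hm v)" using f_eq[of "hm v"] by (simp add: algebra_simps)
      also have "\<dots> \<le> d * v" using v d minus.b by (simp add: minus.g_h min_def)
      finally show ?thesis using c d by (simp add: \<theta>_def field_simps)
    qed
  qed (use \<theta> that plus.h_cont minus.h_cont plus.h_mono minus.h_mono in auto)
  then show ?thesis by blast
qed

text \<open>The quadratic terms at \<open>v_c\<close> cancel and \<open>G_plus g \<gamma> 1\<close>
  is -1/2. Since \<open>v_c\<close> lies below 1 and below \<open>g u_minus\<close>, the extended
  branches agree with the true inverses on the intervals involved.\<close>

lemma v_c_energy: "integral {0..v_c} hp - integral {0..v_c} hm = integral {0..1} hp - 1 / 2"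
proof -
  have v: "0 < v_c" "v_c < 1" using v_c by auto
  have "hp integrable_on {0..1}"
    by (intro integrable_continuous_real continuous_on_subset[OF plus.h_cont]) auto
  then have "integral {0..v_c} hp + integral {v_c..1} hp = integral {0..1} hp"
    using v by (intro Henstock_Kurzweil_Integration.integral_combine) auto
  moreover have "integral {v_c..1} (inv_into {\<gamma>..1} g) = integral {v_c..1} hp"
    using v by (intro Henstock_Kurzweil_Integration.integral_cong) (auto simp: plus.h_eq)
  moreover have "integral {0..v_c} (inv_into {0..\<beta>} g) = integral {0..v_c} hm"
    using order by (intro Henstock_Kurzweil_Integration.integral_cong) (auto simp: minus.h_eq)
  ultimately show ?thesis
    using v_c_eq by (simp add: G_plus_def G_minus_def)
qed

lemma hm_v_c: "hm v_c < u_minus"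
  using minus.h_less_iff(2)[of u_minus v_c] u_minus order v_c by auto

text \<open>The ground states will take their values in this compact set, and
  \<open>hm v_c < u_minus\<close> and \<open>u_plus < hp 0\<close> keep it away from the zeros of
  \<open>deriv f\<close>. It does not depend on \<open>x0\<close>, so \<eta> can be fixed before the
  barriers are chosen.\<close>

lemma f_dissipative:
  obtains \<mu> \<eta> where "0 < \<mu>" "0 < \<eta>"
    "\<And>w s. w \<in> {0..hm v_c} \<union> {hp 0..1} \<Longrightarrow> 0 \<le> s \<Longrightarrow> s \<le> \<eta> \<Longrightarrow> f (w + s) - f w \<le> - \<mu> * s"
    "\<And>w s. w \<in> {0..hm v_c} \<union> {hp 0..1} \<Longrightarrow> 0 \<le> s \<Longrightarrow> s \<le> \<eta> \<Longrightarrow> f w - f (w - s) \<le> - \<mu> * s"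
proof -
  let ?A = "{0..hm v_c} \<union> {hp 0..1}"
  have neg: "deriv f w < 0" if "w \<in> ?A" for w
    using that u_plus u_minus u_plus_less_hp[of 0] hm_v_c by auto
  have A: "compact ?A" "?A \<noteq> {}" using plus.h_mem[of 0] by auto
  obtain \<mu> \<eta> where \<mu>: "0 < \<mu>" "0 < \<eta>"
    and le: "\<And>w s. w \<in> ?A \<Longrightarrow> \<bar>s\<bar> \<le> \<eta> \<Longrightarrow> deriv f (w + s) \<le> - \<mu>"
    using negative_near_compact[OF smooth_deriv(2)[OF f_smooth] neg A] by metis
  show ?thesis
  proof (rule that[OF \<mu>])
    fix w s assume w: "w \<in> ?A" and s: "0 \<le> s" "s \<le> \<eta>"
    have le': "deriv f z \<le> - \<mu>" if "\<bar>z - w\<bar> \<le> \<eta>" for z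
      using le[OF w that] by simp
    show "f (w + s) - f w \<le> - \<mu> * s"
      using s by (intro decrement_le[OF f_has_deriv] le') auto
    show "f w - f (w - s) \<le> - \<mu> * s"
      using s decrement_le[OF f_has_deriv, of "w - s" s \<mu>] le' by auto
  qed
qed

lemma pinned_ground_state:
  assumes "pinned hp hm \<theta> x0"
  obtains U where "ground_state d f U" "{x. \<not> isCont U x} = {- x0, x0}"
    "\<And>x. U x \<in> {0..hm v_c} \<union> {hp 0..1}"
    "\<And>x. x0 < \<bar>x\<bar> \<Longrightarrow> U x \<le> x0 / (1 - \<theta>)"
    "\<And>R \<delta> m n x. 0 < R \<Longrightarrow> 0 \<le> \<delta> \<Longrightarrow> 0 \<le> m \<Longrightarrow>
      (\<And>v. 0 \<le> v \<Longrightarrow> v \<le> m \<Longrightarrow> v + \<delta> \<le> (LINT y|lborel. K y * indicator {-R..R} y) * hp v) \<Longrightarrow>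
      \<bar>x\<bar> \<le> x0 - real n * R \<Longrightarrow> min (real n * \<delta>) m \<le> U x"
proof -
  interpret pinned hp hm \<theta> x0 by (rule assms)
  obtain V where V: "admissible V" and fp: "\<And>x. V x = conv K (profile V) x"
    by (rule fixed_profile_exists) metis
  have V01: "0 \<le> V x" "V x \<le> 1" "V x \<le> x0 / (1 - \<theta>)" for x
    using V by (auto simp: admissible_def)
  have hp_ge: "v \<le> hp v" if "0 \<le> v" "v \<le> 1" for v
    using less_hp[of v] hp_1 that by (cases "v = 1") auto
  have jump: "V x0 \<le> v_c"
    by (rule jump_value_le[OF V fp hp_ge _ v_c_energy]) (use v_c in auto)
  have outer: "V x \<le> v_c" if "x0 < \<bar>x\<bar>" for x
  proof -
    have "V x \<le> V x0" using V that x0 by (auto simp: admissible_def)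
    with jump show ?thesis by simp
  qed
  \<comment> \<open>Inside, \<open>V \<le> 1\<close>; outside,
    \<open>V \<le> v_c < g u_minus\<close>. Neither branch is evaluated where it was extended, so
    this is the original equation.\<close>
  have g_profile: "g (profile V x) = V x" for x
    using V01[of x] outer[of x] order(2) plus.g_h[of "V x"] minus.g_h[of "V x"]
    by (auto simp: branch_profile_def)
  show ?thesis
  proof (rule that[of "profile V"])
    show "ground_state d f (profile V)"
      using g_profile by (intro ground_state_profile V fp hm_pos) (simp add: f_eq algebra_simps)
    show "{x. \<not> isCont (profile V) x} = {- x0, x0}" by (rule profile_discontinuities[OF V fp])
    fix x
    show "profile V x \<in> {0..hm v_c} \<union> {hp 0..1}"
      using hp_le_1[of "V x"] hm_nonneg[of "V x"] monoD[OF plus.h_mono, of 0 "V x"] V01[of x]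
        monoD[OF minus.h_mono, OF outer, of x]
      by (auto simp: branch_profile_def)
    show "profile V x \<le> x0 / (1 - \<theta>)" if "x0 < \<bar>x\<bar>"
    proof -
      have "hm (V x) \<le> \<theta> * V x" by (rule hm_le[OF V01(1)])
      also have "\<dots> \<le> V x" using \<theta> V01(1)[of x] by (intro mult_left_le_one_le) auto
      also have "\<dots> \<le> x0 / (1 - \<theta>)" by (rule V01)
      finally show ?thesis using that by (simp add: branch_profile_def)
    qed
    fix R \<delta> m :: real and n assume R: "0 < R" "0 \<le> \<delta>" "0 \<le> m"
      "\<And>v. 0 \<le> v \<Longrightarrow> v \<le> m \<Longrightarrow> v + \<delta> \<le> (LINT y|lborel. K y * indicator {-R..R} y) * hp v"
      and x: "\<bar>x\<bar> \<le> x0 - real n * R"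
    have "min (real n * \<delta>) m \<le> V x" by (rule fixed_profile_ge[OF V fp R x])
    moreover have "\<bar>x\<bar> \<le> x0" using x R(1) by (smt (verit) mult_nonneg_nonneg of_nat_0_le_iff)
    ultimately show "min (real n * \<delta>) m \<le> profile V x"
      using hp_ge[OF V01(1,2)[of x]] by (simp add: branch_profile_def)
  qed
qed

section \<open>Choice of the two barriers by the position of the jump\<close>

lemma upper_ground_state:
  assumes l: "0 < l" and \<eta>: "0 < \<eta>"
  obtains U x0 where "ground_state d f U" "{x. \<not> isCont U x} = {- x0, x0}" "l \<le> x0"
    "\<And>x. U x \<in> {0..hm v_c} \<union> {hp 0..1}" "\<And>x. \<bar>x\<bar> \<le> l \<Longrightarrow> 1 - \<eta> \<le> U x"
proof -
  \<comment> \<open>\<eta> may exceed 1, and the cap must not be negative.\<close>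
  define m where "m = max 0 (1 - \<eta>)"
  have m: "0 \<le> m" "m < 1" "1 - \<eta> \<le> m" using \<eta> by (auto simp: m_def)
  obtain R \<delta> where R: "0 < R" "0 < \<delta>"
    and step: "\<And>v. 0 \<le> v \<Longrightarrow> v \<le> m \<Longrightarrow> v + \<delta> \<le> (LINT y|lborel. K y * indicator {-R..R} y) * hp v"
  proof (rule uniform_gain[OF plus.h_cont _ m(1)])
    show "hp v \<le> 1" for v using plus.h_mem[of v] by simp
    show "v < hp v" if "0 \<le> v" "v \<le> m" for v using that m by (intro less_hp) auto
  qed metis
  obtain n :: nat where n: "1 / \<delta> < real n" using reals_Archimedean2 by blast
  obtain \<theta> where \<theta>: "\<And>x0. 0 < x0 \<Longrightarrow> pinned hp hm \<theta> x0" using pinned_exists by blast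
  \<comment> \<open>Room for n steps inwards of length \<open>R\<close>; as
    \<open>n * \<delta> > 1\<close>, these steps reach the cap \<open>m\<close>.\<close>
  define x0 where "x0 = l + real n * R"
  have x0: "0 < x0" "l \<le> x0" using l R by (auto simp: x0_def add_pos_nonneg)
  have n\<delta>: "1 < real n * \<delta>" using n R(2) by (simp add: divide_less_eq)
  show ?thesis
  proof (rule pinned_ground_state[OF \<theta>[OF x0(1)]])
    fix U
    assume U: "ground_state d f U" "{x. \<not> isCont U x} = {- x0, x0}"
      "\<And>x. U x \<in> {0..hm v_c} \<union> {hp 0..1}"
      and ge: "\<And>R \<delta> m n x. 0 < R \<Longrightarrow> 0 \<le> \<delta> \<Longrightarrow> 0 \<le> m \<Longrightarrow>
        (\<And>v. 0 \<le> v \<Longrightarrow> v \<le> m \<Longrightarrow> v + \<delta> \<le> (LINT y|lborel. K y * indicator {-R..R} y) * hp v) \<Longrightarrow>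
        \<bar>x\<bar> \<le> x0 - real n * R \<Longrightarrow> min (real n * \<delta>) m \<le> U x"
    have "1 - \<eta> \<le> U x" if "\<bar>x\<bar> \<le> l" for x
      using ge[OF R(1) less_imp_le[OF R(2)] m(1) step, of x n] that m n\<delta> by (simp add: x0_def)
    with U(1,2) x0(2) U(3) show ?thesis by (rule that)
  qed
qed

lemma lower_ground_state:
  assumes l: "0 < l" and \<eta>: "0 < \<eta>"
  obtains U x0 where "ground_state d f U" "{x. \<not> isCont U x} = {- x0, x0}" "0 < x0" "x0 \<le> l"
    "\<And>x. U x \<in> {0..hm v_c} \<union> {hp 0..1}" "\<And>x. x0 < \<bar>x\<bar> \<Longrightarrow> U x \<le> \<eta>"
proof -
  obtain \<theta> where \<theta>: "\<And>x0. 0 < x0 \<Longrightarrow> pinned hp hm \<theta> x0" using pinned_exists by blast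
  have \<theta>1: "\<theta> < 1" using \<theta>[OF l] by (simp add: pinned_def)
  \<comment> \<open>The second bound makes the height estimate \<open>x0 / (1 - \<theta>)\<close> at
    most \<eta>.\<close>
  define x0 where "x0 = min l (\<eta> * (1 - \<theta>))"
  have x0: "0 < x0" "x0 \<le> l" "x0 / (1 - \<theta>) \<le> \<eta>"
    using l \<eta> \<theta>1 by (auto simp: x0_def pos_divide_le_eq)
  show ?thesis
  proof (rule pinned_ground_state[OF \<theta>[OF x0(1)]])
    fix U
    assume U: "ground_state d f U" "{x. \<not> isCont U x} = {- x0, x0}"
      "\<And>x. U x \<in> {0..hm v_c} \<union> {hp 0..1}"
      and le: "\<And>x. x0 < \<bar>x\<bar> \<Longrightarrow> U x \<le> x0 / (1 - \<theta>)"
    have "U x \<le> \<eta>" if "x0 < \<bar>x\<bar>" for x using le[OF that] x0(3) by simp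
    with U(1,2) x0(1,2) U(3) show ?thesis by (rule that)
  qed
qed

section \<open>Squeezing the solution between the two barriers\<close>

theorem pinned_between_ground_states:
  assumes l: "0 < l" and u: "cauchy_solution d f (indicator {-l..l}) u"
  shows "\<exists>U_low U_up x_low x_up.
       ground_state d f U_low \<and> {x. \<not> isCont U_low x} = {-x_low, x_low} \<and>
       ground_state d f U_up \<and> {x. \<not> isCont U_up x} = {-x_up, x_up} \<and>
       0 < x_low \<and> x_low \<le> l \<and> l \<le> x_up \<and>
       (\<forall>\<epsilon>>0. \<exists>T>0. \<forall>t\<ge>T. \<forall>x. U_low x - \<epsilon> \<le> u t x \<and> u t x \<le> U_up x + \<epsilon>)"
proof -
  obtain \<mu> \<eta> where \<mu>: "0 < \<mu>" "0 < \<eta>" and diss: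
    "\<And>w s. w \<in> {0..hm v_c} \<union> {hp 0..1} \<Longrightarrow> 0 \<le> s \<Longrightarrow> s \<le> \<eta> \<Longrightarrow> f (w + s) - f w \<le> - \<mu> * s"
    "\<And>w s. w \<in> {0..hm v_c} \<union> {hp 0..1} \<Longrightarrow> 0 \<le> s \<Longrightarrow> s \<le> \<eta> \<Longrightarrow> f w - f (w - s) \<le> - \<mu> * s"
    by (rule f_dissipative) metis
  obtain U1 x1 where U1: "ground_state d f U1" "{x. \<not> isCont U1 x} = {- x1, x1}" "l \<le> x1"
    "\<And>x. U1 x \<in> {0..hm v_c} \<union> {hp 0..1}" "\<And>x. \<bar>x\<bar> \<le> l \<Longrightarrow> 1 - \<eta> \<le> U1 x"
    using upper_ground_state[OF l \<mu>(2)] by metis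
  obtain U2 x2 where U2: "ground_state d f U2" "{x. \<not> isCont U2 x} = {- x2, x2}" "0 < x2" "x2 \<le> l"
    "\<And>x. U2 x \<in> {0..hm v_c} \<union> {hp 0..1}" "\<And>x. x2 < \<bar>x\<bar> \<Longrightarrow> U2 x \<le> \<eta>"
    using lower_ground_state[OF l \<mu>(2)] by metis
  have range: "{0..hm v_c} \<union> {hp 0..1} \<subseteq> {0..1}"
    using hm_le_u_minus[of v_c] u_minus \<beta>\<gamma> plus.h_mem[of 0] by auto
  have U01: "0 \<le> U1 x" "U1 x \<le> 1" "0 \<le> U2 x" "U2 x \<le> 1" for x
    using subsetD[OF range U1(4)[of x]] subsetD[OF range U2(5)[of x]] by auto
  have init: "u 0 x = indicator {-l..l} x" for x using u by (simp add: cauchy_solution_def)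
  note lip = locally_lipschitz_of_C1[OF f_has_deriv smooth_deriv(2)[OF f_smooth]]
  interpret pointwise_solution d f u by (rule cauchy_solution_pointwise[OF u])
  interpret up: stable_from_above d f u U1 \<eta> \<mu> 1
  proof
    show "U1 \<in> borel_measurable lebesgue" "rhs d f U1 x = 0" for x
      using U1(1) by (auto simp: ground_state_def)
    \<comment> \<open>On \<open>{-l..l}\<close> the barrier is at least 1 by the choice of
      \<open>U1\<close>; elsewhere the initial value is 0.\<close>
    show "u 0 x \<le> U1 x + \<eta>" for x
      using U1(5)[of x] U01(1)[of x] \<mu>(2) by (auto simp: init indicator_def abs_le_iff)
  qed (use d \<mu> U01 U1 diss lip in \<open>auto simp: abs_le_iff\<close>)
  interpret down: stable_from_above d "\<lambda>v. - f (- v)" "\<lambda>t x. - u t x" "\<lambda>x. - U2 x" \<eta> \<mu> 1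
  proof (intro stable_from_above.intro stable_from_above_axioms.intro pointwise_solution_minus)
    show "(\<lambda>x. - U2 x) \<in> borel_measurable lebesgue" "rhs d (\<lambda>v. - f (- v)) (\<lambda>x. - U2 x) x = 0" for x
      unfolding rhs_minus using U2(1) by (auto simp: ground_state_def)
    \<comment> \<open>On \<open>{-l..l}\<close> the initial value 1 dominates \<open>U2\<close>;
      elsewhere \<open>x2 \<le> l\<close> puts x beyond the jump, where
      \<open>U2 \<le> \<eta>\<close>.\<close>
    show "- u 0 x \<le> - U2 x + \<eta>" for x
      using U2(4) U2(6)[of x] U01(4)[of x] \<mu>(2) by (auto simp: init indicator_def not_le abs_le_iff)
    show "\<exists>L. \<forall>v w. \<bar>v\<bar> \<le> R \<longrightarrow> \<bar>w\<bar> \<le> R \<longrightarrow> \<bar>- f (- v) - - f (- w)\<bar> \<le> L * \<bar>v - w\<bar>" for R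
    proof -
      obtain L where L: "\<And>v w. \<bar>v\<bar> \<le> R \<Longrightarrow> \<bar>w\<bar> \<le> R \<Longrightarrow> \<bar>f v - f w\<bar> \<le> L * \<bar>v - w\<bar>"
        using lip[of R] by blast
      have "\<bar>- f (- v) - - f (- w)\<bar> \<le> L * \<bar>v - w\<bar>" if "\<bar>v\<bar> \<le> R" "\<bar>w\<bar> \<le> R" for v w
        using L[of "- w" "- v"] that by simp
      then show ?thesis by blast
    qed
    show "- f (- (- U2 x + s)) - - f (- (- U2 x)) \<le> - \<mu> * s" if "0 \<le> s" "s \<le> \<eta>" for x s
      using diss(2)[OF U2(5) that, of x] by simp
  qed (use d \<mu> U01 in auto)
  have "\<exists>T>0. \<forall>t\<ge>T. \<forall>x. U2 x - \<epsilon> \<le> u t x \<and> u t x \<le> U1 x + \<epsilon>" if \<epsilon>: "0 < \<epsilon>" for \<epsilon>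
  proof -
    have "((\<lambda>t. \<eta> * exp (- \<mu> * t)) \<longlongrightarrow> 0) at_top" using \<mu>(1) by real_asymp
    then have "\<forall>\<^sub>F t in at_top. \<eta> * exp (- \<mu> * t) < \<epsilon>" using \<epsilon> by (rule order_tendstoD)
    then obtain T where T: "\<And>t. T \<le> t \<Longrightarrow> \<eta> * exp (- \<mu> * t) < \<epsilon>"
      by (auto simp: eventually_at_top_linorder)
    have "U2 x - \<epsilon> \<le> u t x \<and> u t x \<le> U1 x + \<epsilon>" if t: "max 1 T \<le> t" for t x
      using up.le_stationary_plus_exp[of t x] down.le_stationary_plus_exp[of t x] T[of t] t by simp
    then show ?thesis by (intro exI[of _ "max 1 T"]) auto
  qed
  with U1 U2 show ?thesis by (intro exI[of _ U2] exI[of _ U1] exI[of _ x2] exI[of _ x1]) simp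
qed

end

theorem corollary4p4:
  fixes d a \<beta> \<gamma> v_c u_plus u_minus :: real
    and f g :: "real \<Rightarrow> real"
  assumes d: "d > 0"
    and f_smooth: "smooth f"
    and a: "0 < a" "a < 1"
    and f_zeros: "f 0 = 0" "f a = 0" "f 1 = 0"
    and f_neg: "\<forall>u\<in>{0<..<a}. f u < 0"
    and f_pos: "\<forall>u\<in>{a<..<1}. f u > 0"
    and f_deriv: "deriv f 0 < 0" "deriv f 1 < 0" "deriv f a > 0"
    and f_int: "integral {0..1} f > 0"
    and g: "\<forall>u. g u = u - f u / d"
    and \<beta>\<gamma>: "0 < \<beta>" "\<beta> < \<gamma>" "\<gamma> < 1"
    and g_incr: "\<forall>u\<in>{0..<\<beta>} \<union> {\<gamma><..1}. deriv g u > 0"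
    and g_decr: "\<forall>u\<in>{\<beta><..<\<gamma>}. deriv g u < 0"
    and g_crit: "deriv g \<beta> = 0" "deriv g \<gamma> = 0"
    and G_minus_neg: "G_minus g \<beta> (g \<beta>) < 0"
    and G_plus_dom: "g \<beta> \<in> {g \<gamma>..1}"
    and G_ineq: "- G_minus g \<beta> (g \<beta>) \<ge> G_plus g \<gamma> 1 - G_plus g \<gamma> (g \<beta>)"
    and v_c: "v_c \<in> {0<..g \<beta>} \<inter> {g \<gamma>..<1}"
    and v_c_eq: "G_plus g \<gamma> v_c - G_minus g \<beta> v_c = G_plus g \<gamma> 1"
    and u_plus: "u_plus \<in> {\<gamma><..<1}" "deriv f u_plus = 0" "\<forall>u\<in>{u_plus<..1}. deriv f u < 0"
    and u_minus: "u_minus \<in> {0<..<\<beta>}" "deriv f u_minus = 0" "\<forall>u\<in>{0..<u_minus}. deriv f u < 0"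
    and order: "g u_plus < 0" "0 < v_c" "v_c < g u_minus"
  shows "\<forall>l>0. \<forall>u. cauchy_solution d f (indicator {-l..l}) u \<longrightarrow>
    (\<exists>U_low U_up x_low x_up.
       ground_state d f U_low \<and> {x. \<not> isCont U_low x} = {-x_low, x_low} \<and>
       ground_state d f U_up \<and> {x. \<not> isCont U_up x} = {-x_up, x_up} \<and>
       0 < x_low \<and> x_low \<le> l \<and> l \<le> x_up \<and>
       (\<forall>\<epsilon>>0. \<exists>T>0. \<forall>t\<ge>T. \<forall>x\<in>UNIV - {x_low, -x_low, x_up, -x_up}.
          U_low x - \<epsilon> \<le> u t x \<and> u t x \<le> U_up x + \<epsilon>))"
proof (intro allI impI)
  fix l :: real and u assume l: "0 < l" and u: "cauchy_solution d f (indicator {-l..l}) u"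
  interpret bistable d a \<beta> \<gamma> v_c u_plus u_minus f g
    by unfold_locales (fact assms order)+
  obtain U_low U_up x_low x_up where
    "ground_state d f U_low" "{x. \<not> isCont U_low x} = {-x_low, x_low}"
    "ground_state d f U_up" "{x. \<not> isCont U_up x} = {-x_up, x_up}"
    "0 < x_low" "x_low \<le> l" "l \<le> x_up"
    and squeeze: "\<forall>\<epsilon>>0. \<exists>T>0. \<forall>t\<ge>T. \<forall>x. U_low x - \<epsilon> \<le> u t x \<and> u t x \<le> U_up x + \<epsilon>"
    using pinned_between_ground_states[OF l u] by blast
  moreover have "\<forall>\<epsilon>>0. \<exists>T>0. \<forall>t\<ge>T. \<forall>x\<in>UNIV - {x_low, -x_low, x_up, -x_up}.
      U_low x - \<epsilon> \<le> u t x \<and> u t x \<le> U_up x + \<epsilon>"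
    using squeeze by blast
  ultimately show "\<exists>U_low U_up x_low x_up.
       ground_state d f U_low \<and> {x. \<not> isCont U_low x} = {-x_low, x_low} \<and>
       ground_state d f U_up \<and> {x. \<not> isCont U_up x} = {-x_up, x_up} \<and>
       0 < x_low \<and> x_low \<le> l \<and> l \<le> x_up \<and>
       (\<forall>\<epsilon>>0. \<exists>T>0. \<forall>t\<ge>T. \<forall>x\<in>UNIV - {x_low, -x_low, x_up, -x_up}.
          U_low x - \<epsilon> \<le> u t x \<and> u t x \<le> U_up x + \<epsilon>)"
    by blast
qed

end
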